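(* Let $X \subseteq \omega$ be $1$-generic. Then every set in $X^{\mathfrak c}$ is computable (i.e. $X^{\mathfrak c} = \mathbf 0$), and hence $\mathcal E(A) \not\leq_{\mathrm{nc}} X$ for all noncomputable $A \subseteq \omega$. In particular, in both the uniform and nonuniform coarse degrees, the degree of $X$ is not in the image of the embedding induced by $\mathcal E$; that is, for every $B \subseteq \omega$ we have $X \not\equiv_{\mathrm{uc}} \mathcal E(B)$ and $X \not\equiv_{\mathrm{nc}} \mathcal E(B)$.
   Context: For $A \subseteq \omega$ and $n \geq 1$ let $\rho_n(A) = |A \cap [0,n)|/n$; the density $\rho(A)$ is $\lim_n \rho_n(A)$ when it exists. $D$ is a coarse description of $X$ if $\rho(D \triangle X) = 0$. $X^{\mathfrak c}$ is the class of all $A$ that are computable from every coarse description of $X$; $\mathbf 0$ denotes the class of computable sets. $Y \leq_{\mathrm{uc}} X$ if there is a Turing functional $\Phi$ such that for every coarse description $D$ of $X$, $\Phi^D$ is a coarse description of $Y$. $Y \leq_{\mathrm{nc}} X$ if every coarse description of $X$ computes a coarse description of $Y$. The induced equivalence relations are $\equiv_{\mathrm{uc}}$ and $\equiv_{\mathrm{nc}}$, and their equivalence classes are the uniform and nonuniform coarse degrees. Let $I_n = [n!,(n+1)!)$, $\mathcal I(A) = \bigcup_{n \in A} I_n$, $\mathcal H(A) = \{\langle n,i\rangle : n \in A,\ i \in \omega\}$ (with $\langle\cdot,\cdot\rangle$ a computable pairing function), and $\mathcal E(A) = \mathcal I(\mathcal H(A))$. The embedding induced by $\mathcal E$ sends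 the Turing degree of $A$ to the (uniform, respectively nonuniform) coarse degree of $\mathcal E(A)$. $X$ is $1$-generic if for every c.e. set $S \subseteq 2^{<\omega}$, either some initial segment of $X$ is in $S$, or some initial segment of $X$ has no extension in $S$. *)

theory Defs
  imports Complex_Main "HOL-Library.Nat_Bijection" "HOL-Library.Sublist"
begin

section \<open>Oracle computation\<close>

text \<open>Turing functionals are given by Kleene's partial recursive functions relative to an oracle:
  the initial functions together with the characteristic function of the oracle, closed under
  composition, primitive recursion and unbounded minimisation.\<close>

datatype functional =
    Zero
  | Succ
  | Proj nat
  | Query
  | Comp functional "functional list"
  | Rec functional functional
  | Mu functional

text \<open>\<open>run D e xs y\<close>: the computation of \<open>e\<close> with oracle \<open>D\<close> on the argument tuple \<open>xs\<close> halts with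
  output \<open>y\<close>. Arities are not part of the syntax: \<open>Zero\<close> is the constant function of every arity,
  \<open>Proj i\<close> returns the argument with index \<open>i\<close> (from 0) of any tuple that has one, and there is no
  output when the tuple does not fit.\<close>

inductive run :: "nat set \<Rightarrow> functional \<Rightarrow> nat list \<Rightarrow> nat \<Rightarrow> bool" for D :: "nat set" where
  run_Zero: "run D Zero xs 0"
| run_Succ: "run D Succ [x] (Suc x)"
| run_Proj: "i < length xs \<Longrightarrow> run D (Proj i) xs (xs ! i)"
| run_Query: "run D Query [x] (of_bool (x \<in> D))"
| run_Comp: "list_all2 (\<lambda>g y. run D g xs y) gs ys \<Longrightarrow> run D f ys z \<Longrightarrow> run D (Comp f gs) xs z"
| run_Rec_0: "run D f xs y \<Longrightarrow> run D (Rec f g) (0 # xs) y"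
| run_Rec_Suc: "run D (Rec f g) (n # xs) r \<Longrightarrow> run D g (n # r # xs) y
    \<Longrightarrow> run D (Rec f g) (Suc n # xs) y"
| run_Mu: "run D f (n # xs) 0 \<Longrightarrow> (\<forall>m<n. \<exists>y. run D f (m # xs) (Suc y)) \<Longrightarrow> run D (Mu f) xs n"

inductive_cases run_ZeroE: "run D Zero xs y"
inductive_cases run_SuccE: "run D Succ xs y"
inductive_cases run_ProjE: "run D (Proj i) xs y"
inductive_cases run_QueryE: "run D Query xs y"
inductive_cases run_CompE: "run D (Comp f gs) xs y"
inductive_cases run_Rec_0E: "run D (Rec f g) (0 # xs) y"
inductive_cases run_Rec_SucE: "run D (Rec f g) (Suc n # xs) y"
inductive_cases run_MuE: "run D (Mu f) xs y"

lemma run_deterministic: "run D e xs y \<Longrightarrow> run D e xs z \<Longrightarrow> y = z"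
proof (induction arbitrary: z rule: run.induct)
  case (run_Comp xs gs ys f w)
  from run_Comp.prems obtain ys' where ys': "list_all2 (\<lambda>g y. run D g xs y) gs ys'" "run D f ys' z"
    by (rule run_CompE)
  have "ys = ys'"
  proof (rule nth_equalityI)
    show "length ys = length ys'"
      using list_all2_lengthD[OF run_Comp.IH(1)] list_all2_lengthD[OF ys'(1)] by simp
    show "ys ! i = ys' ! i" if "i < length ys" for i
      using list_all2_nthD2[OF run_Comp.IH(1) that] list_all2_nthD[OF ys'(1), of i]
        that list_all2_lengthD[OF run_Comp.IH(1)] by auto
  qed
  with ys'(2) run_Comp.IH(2) show ?case by blast
next
  case (run_Rec_Suc f g n xs r y)
  from run_Rec_Suc.prems obtain r' where r': "run D (Rec f g) (n # xs) r'" "run D g (n # r' # xs) z"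
    by (rule run_Rec_SucE)
  from run_Rec_Suc.IH(1)[OF r'(1)] r'(2) have "run D g (n # r # xs) z" by simp
  then show ?case by (rule run_Rec_Suc.IH(2))
next
  case (run_Mu f n xs)
  from run_Mu.prems have z: "run D f (z # xs) 0" "\<forall>m<z. \<exists>y. run D f (m # xs) (Suc y)"
    by (rule run_MuE, simp)+
  have "\<not> n < z" using z(2) run_Mu.IH(1) by fastforce
  moreover have "\<not> z < n" using z(1) run_Mu.IH(2) by fastforce
  ultimately show ?case by simp
qed (erule run_ZeroE run_SuccE run_ProjE run_QueryE run_Rec_0E; simp)+

text \<open>\<open>computes e D A\<close>: \<open>e\<close> with oracle \<open>D\<close> is total, and it is the characteristic function of \<open>A\<close>.\<close>

definition computes :: "functional \<Rightarrow> nat set \<Rightarrow> nat set \<Rightarrow> bool" where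
  "computes e D A \<longleftrightarrow> (\<forall>n. run D e [n] (of_bool (n \<in> A)))"

definition turing_le :: "nat set \<Rightarrow> nat set \<Rightarrow> bool" (infix "\<le>\<^sub>T" 50) where
  "A \<le>\<^sub>T D \<longleftrightarrow> (\<exists>e. computes e D A)"

text \<open>Unrelativised computability is computability with the empty oracle.\<close>

definition computable :: "nat set \<Rightarrow> bool" where
  "computable A \<longleftrightarrow> A \<le>\<^sub>T {}"

definition string_code :: "bool list \<Rightarrow> nat" where
  "string_code \<sigma> = list_encode (map of_bool \<sigma>)"

text \<open>A set of strings is c.e. if it is the domain of a partial computable function on strings.\<close>

definition ce_strings :: "bool list set \<Rightarrow> bool" where
  "ce_strings S \<longleftrightarrow> (\<exists>e. \<forall>\<sigma>. \<sigma> \<in> S \<longleftrightarrow> (\<exists>y. run {} e [string_code \<sigma>] y))"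


section \<open>Genericity\<close>

definition initial_segment :: "nat set \<Rightarrow> nat \<Rightarrow> bool list" where
  "initial_segment X n = map (\<lambda>i. i \<in> X) [0..<n]"

definition one_generic :: "nat set \<Rightarrow> bool" where
  "one_generic X \<longleftrightarrow>
    (\<forall>S. ce_strings S \<longrightarrow>
      (\<exists>n. initial_segment X n \<in> S) \<or>
      (\<exists>n. \<not> (\<exists>\<tau>\<in>S. prefix (initial_segment X n) \<tau>)))"


section \<open>Density and coarse reducibility\<close>

definition partial_density :: "nat set \<Rightarrow> nat \<Rightarrow> real" where
  "partial_density A n = real (card (A \<inter> {0..<n})) / real n"

definition has_density :: "nat set \<Rightarrow> real \<Rightarrow> bool" where
  "has_density A d \<longleftrightarrow> partial_density A \<longlonglongrightarrow> d"

definition coarse_description :: "nat set \<Rightarrow> nat set \<Rightarrow> bool" where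
  "coarse_description D X \<longleftrightarrow> has_density (sym_diff D X) 0"

definition coarse_core :: "nat set \<Rightarrow> nat set set" where
  "coarse_core X = {A. \<forall>D. coarse_description D X \<longrightarrow> A \<le>\<^sub>T D}"

definition uc_le :: "nat set \<Rightarrow> nat set \<Rightarrow> bool" (infix "\<le>\<^sub>u\<^sub>c" 50) where
  "Y \<le>\<^sub>u\<^sub>c X \<longleftrightarrow>
    (\<exists>e. \<forall>D. coarse_description D X \<longrightarrow> (\<exists>C. computes e D C \<and> coarse_description C Y))"

definition nc_le :: "nat set \<Rightarrow> nat set \<Rightarrow> bool" (infix "\<le>\<^sub>n\<^sub>c" 50) where
  "Y \<le>\<^sub>n\<^sub>c X \<longleftrightarrow>
    (\<forall>D. coarse_description D X \<longrightarrow> (\<exists>C. C \<le>\<^sub>T D \<and> coarse_description C Y))"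

definition uc_equiv :: "nat set \<Rightarrow> nat set \<Rightarrow> bool" (infix "\<equiv>\<^sub>u\<^sub>c" 50) where
  "X \<equiv>\<^sub>u\<^sub>c Y \<longleftrightarrow> X \<le>\<^sub>u\<^sub>c Y \<and> Y \<le>\<^sub>u\<^sub>c X"

definition nc_equiv :: "nat set \<Rightarrow> nat set \<Rightarrow> bool" (infix "\<equiv>\<^sub>n\<^sub>c" 50) where
  "X \<equiv>\<^sub>n\<^sub>c Y \<longleftrightarrow> X \<le>\<^sub>n\<^sub>c Y \<and> Y \<le>\<^sub>n\<^sub>c X"

definition uc_degree :: "nat set \<Rightarrow> nat set set" where
  "uc_degree X = {Y. X \<equiv>\<^sub>u\<^sub>c Y}"

definition nc_degree :: "nat set \<Rightarrow> nat set set" where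
  "nc_degree X = {Y. X \<equiv>\<^sub>n\<^sub>c Y}"


section \<open>The embedding of the Turing degrees\<close>

definition factorial_interval :: "nat \<Rightarrow> nat set" where
  "factorial_interval n = {fact n..<fact (n + 1)}"

definition interval_coding :: "nat set \<Rightarrow> nat set" ("\<I>") where
  "\<I> A = (\<Union>n\<in>A. factorial_interval n)"

definition column_coding :: "nat set \<Rightarrow> nat set" ("\<H>") where
  "\<H> A = {prod_encode (n, i) | n i. n \<in> A}"

definition embedding_coding :: "nat set \<Rightarrow> nat set" ("\<E>") where
  "\<E> A = \<I> (\<H> A)"

text \<open>The embeddings send the Turing degree of \<open>A\<close> to the degree of \<open>\<E> A\<close>, so their images consist
  of the degrees of the sets \<open>\<E> A\<close>.\<close>

definition uc_embedding_image :: "nat set set set" where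
  "uc_embedding_image = {uc_degree (\<E> A) | A. True}"

definition nc_embedding_image :: "nat set set set" where
  "nc_embedding_image = {nc_degree (\<E> A) | A. True}"

end

theory Submission
  imports Defs "HOL-Library.Countable"
begin

text \<open>Let \<open>X\<close> be 1-generic. If \<open>A\<close> is computable both from \<open>X - R1\<close> and from \<open>X - R2\<close>, for disjoint
  computable \<open>R1\<close> and \<open>R2\<close>, then it is computable from \<open>X - (R1 \<union> R2)\<close>. A noncomputable \<open>A\<close> is not
  computable from \<open>X - UNIV\<close>, so by repeated halving there are residue classes \<open>R k\<close> modulo
  \<open>2 ^ k\<close>, decreasing in \<open>k\<close>, such that \<open>A\<close> is never computable from \<open>X - R k\<close>. A finite extension
  construction that changes \<open>X\<close> from stage \<open>k\<close> on only inside \<open>R k\<close> then gives a coarse description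
  of \<open>X\<close> that does not compute \<open>A\<close>.

  A coarse description of \<open>\<E> A\<close> computes \<open>A\<close> by majority vote on the intervals, so \<open>\<E> A \<le>\<^sub>n\<^sub>c X\<close>
  puts \<open>A\<close> into the coarse core of \<open>X\<close>. If moreover \<open>X \<le>\<^sub>n\<^sub>c \<E> A\<close>, then \<open>X\<close> would have a computable
  coarse description \<open>C\<close>, while genericity makes \<open>X\<close> differ from \<open>C\<close> on intervals \<open>[j, 2j)\<close> for
  arbitrarily large \<open>j\<close>.\<close>

section \<open>Functions computable relative to an oracle\<close>

text \<open>Only tuples of length \<open>k\<close> count. Functions are therefore written as terms
  in a tuple \<open>v\<close>, and their computability follows by closure rules without writing out
  functionals.\<close>

definition computable_in :: "nat set \<Rightarrow> nat \<Rightarrow> (nat list \<Rightarrow> nat) \<Rightarrow> bool" where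
  "computable_in D k f \<longleftrightarrow> (\<exists>e. \<forall>xs. length xs = k \<longrightarrow> run D e xs (f xs))"

named_theorems computable_intros

lemma computable_in_cong:
  "computable_in D k f \<Longrightarrow> (\<And>xs. length xs = k \<Longrightarrow> f xs = g xs) \<Longrightarrow> computable_in D k g"
  unfolding computable_in_def by auto

lemma computable_in_nth [computable_intros]: "i < k \<Longrightarrow> computable_in D k (\<lambda>v. v ! i)"
  unfolding computable_in_def by (rule exI[of _ "Proj i"]) (auto intro: run_Proj)

lemma computable_in_zero: "computable_in D k (\<lambda>v. 0)"
  unfolding computable_in_def by (rule exI[of _ Zero]) (auto intro: run_Zero)

lemma computable_in_comp:
  assumes "computable_in D (length gs) h" and "\<And>g. g \<in> set gs \<Longrightarrow> computable_in D k g"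
  shows "computable_in D k (\<lambda>v. h (map (\<lambda>g. g v) gs))"
proof -
  from assms(1) obtain eh where eh: "length xs = length gs \<Longrightarrow> run D eh xs (h xs)" for xs
    unfolding computable_in_def by auto
  from assms(2) have "\<forall>g\<in>set gs. \<exists>e. \<forall>xs. length xs = k \<longrightarrow> run D e xs (g xs)"
    unfolding computable_in_def by auto
  then obtain E where E: "g \<in> set gs \<Longrightarrow> length xs = k \<Longrightarrow> run D (E g) xs (g xs)" for g xs
    by metis
  have "run D (Comp eh (map E gs)) xs (h (map (\<lambda>g. g xs) gs))" if "length xs = k" for xs
  proof (rule run_Comp)
    show "list_all2 (\<lambda>g. run D g xs) (map E gs) (map (\<lambda>g. g xs) gs)"
      using E that by (auto simp: list_all2_conv_all_nth)
    show "run D eh (map (\<lambda>g. g xs) gs) (h (map (\<lambda>g. g xs) gs))" by (rule eh) simp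
  qed
  then show ?thesis unfolding computable_in_def by blast
qed

lemma computable_in_comp1:
  assumes "computable_in D 1 (\<lambda>v. h (v ! 0))" and "computable_in D k f"
  shows "computable_in D k (\<lambda>v. h (f v))"
  using computable_in_comp[of D "[f]" "\<lambda>v. h (v ! 0)" k] assms by simp

lemma computable_in_comp2:
  assumes "computable_in D 2 (\<lambda>v. h (v ! 0) (v ! 1))" and "computable_in D k f" "computable_in D k g"
  shows "computable_in D k (\<lambda>v. h (f v) (g v))"
  using computable_in_comp[of D "[f, g]" "\<lambda>v. h (v ! 0) (v ! 1)" k] assms
  by (auto simp: numeral_2_eq_2)

lemma computable_in_Suc [computable_intros]:
  assumes "computable_in D k f"
  shows "computable_in D k (\<lambda>v. Suc (f v))"
proof (rule computable_in_comp1[OF _ assms])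
  have "run D Succ xs (Suc (xs ! 0))" if "length xs = 1" for xs
    using that by (cases xs) (auto intro: run_Succ)
  then show "computable_in D 1 (\<lambda>v. Suc (v ! 0))" unfolding computable_in_def by blast
qed

lemma computable_in_const [computable_intros]: "computable_in D k (\<lambda>v. c)"
  by (induction c) (auto intro: computable_in_zero computable_in_Suc)

lemma computable_in_oracle [computable_intros]:
  assumes "computable_in D k f"
  shows "computable_in D k (\<lambda>v. of_bool (f v \<in> D))"
proof (rule computable_in_comp1[OF _ assms])
  have "run D Query xs (of_bool (xs ! 0 \<in> D))" if "length xs = 1" for xs
    using that run_Query[of D "hd xs"] by (cases xs) auto
  then show "computable_in D 1 (\<lambda>v. of_bool (v ! 0 \<in> D))" unfolding computable_in_def by blast
qed

lemma turing_le_iff: "A \<le>\<^sub>T D \<longleftrightarrow> computable_in D 1 (\<lambda>v. of_bool (v ! 0 \<in> A))"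
proof
  assume "A \<le>\<^sub>T D"
  then obtain e where "run D e [n] (of_bool (n \<in> A))" for n
    unfolding turing_le_def computes_def by blast
  then have "run D e xs (of_bool (xs ! 0 \<in> A))" if "length xs = 1" for xs
    using that by (cases xs) auto
  then show "computable_in D 1 (\<lambda>v. of_bool (v ! 0 \<in> A))" unfolding computable_in_def by blast
next
  assume "computable_in D 1 (\<lambda>v. of_bool (v ! 0 \<in> A))"
  then obtain e where "\<And>xs. length xs = 1 \<Longrightarrow> run D e xs (of_bool (xs ! 0 \<in> A))"
    unfolding computable_in_def by blast
  from this[of "[n]" for n] have "computes e D A" unfolding computes_def by simp
  then show "A \<le>\<^sub>T D" unfolding turing_le_def by blast
qed

lemma computable_in_mem:
  "A \<le>\<^sub>T D \<Longrightarrow> computable_in D k f \<Longrightarrow> computable_in D k (\<lambda>v. of_bool (f v \<in> A))"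
  unfolding turing_le_iff by (rule computable_in_comp1)

lemma computable_in_nth_drop [computable_intros]:
  "i + j < k \<Longrightarrow> computable_in D k (\<lambda>v. drop j v ! i)"
  by (rule computable_in_cong[OF computable_in_nth[of "i + j"]]) (auto simp: add.commute)

text \<open>Primitive recursion puts the counter and the previous value in front of the parameters;
  this rule discards both.\<close>

lemma computable_in_drop2:
  assumes "computable_in D k f"
  shows "computable_in D (Suc (Suc k)) (\<lambda>v. f (drop 2 v))"
proof (rule computable_in_cong)
  show "computable_in D (Suc (Suc k)) (\<lambda>v. f (map (\<lambda>g. g v) (map (\<lambda>i v. v ! (2 + i)) [0..<k])))"
    by (rule computable_in_comp) (use assms in \<open>auto intro: computable_in_nth\<close>)
  show "f (map (\<lambda>g. g v) (map (\<lambda>i v. v ! (2 + i)) [0..<k])) = f (drop 2 v)"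
    if "length v = Suc (Suc k)" for v
    by (rule arg_cong[of _ _ f], rule nth_equalityI) (use that in auto)
qed

text \<open>\<open>Rec\<close> recurses on its first argument. Composing it with \<open>n\<close>
  and all projections recurses on the value \<open>n v\<close> while keeping the whole tuple
  \<open>v\<close> as parameters.\<close>

lemma computable_in_rec:
  assumes "computable_in D k a"
    and "computable_in D (Suc (Suc k)) (\<lambda>w. G (w ! 0) (w ! 1) (drop 2 w))"
    and "computable_in D k n"
  shows "computable_in D k (\<lambda>v. rec_nat (a v) (\<lambda>m r. G m r v) (n v))"
proof -
  from assms(1) obtain ea where ea: "length v = k \<Longrightarrow> run D ea v (a v)" for v
    unfolding computable_in_def by auto
  from assms(2) obtain eG where
    "length w = Suc (Suc k) \<Longrightarrow> run D eG w (G (w ! 0) (w ! 1) (drop 2 w))" for w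
    unfolding computable_in_def by auto
  from this[of "_ # _ # _"] have eG: "length v = k \<Longrightarrow> run D eG (m # r # v) (G m r v)" for m r v
    by simp
  from assms(3) obtain en where en: "length v = k \<Longrightarrow> run D en v (n v)" for v
    unfolding computable_in_def by auto
  have rec: "run D (Rec ea eG) (m # v) (rec_nat (a v) (\<lambda>m r. G m r v) m)" if "length v = k" for m v
    by (induction m) (use ea eG that in \<open>auto intro: run_Rec_0 run_Rec_Suc\<close>)
  have "run D (Comp (Rec ea eG) (en # map Proj [0..<k])) v (rec_nat (a v) (\<lambda>m r. G m r v) (n v))"
    if "length v = k" for v
  proof (rule run_Comp)
    show "list_all2 (\<lambda>g. run D g v) (en # map Proj [0..<k]) (n v # v)"
      using en that by (auto simp: list_all2_conv_all_nth nth_Cons intro: run_Proj split: nat.split)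
  qed (use rec that in simp)
  then show ?thesis unfolding computable_in_def by blast
qed

text \<open>\<open>Mu\<close> searches for the value \<open>0\<close>, hence the negation. The
  second hypothesis makes the search terminate.\<close>

lemma computable_in_Least:
  assumes "computable_in D (Suc k) (\<lambda>w. of_bool (\<not> P (w ! 0) (drop 1 w)))"
    and "\<And>v. length v = k \<Longrightarrow> \<exists>n. P n v"
  shows "computable_in D k (\<lambda>v. LEAST n. P n v)"
proof -
  from assms(1) obtain e where
    "length w = Suc k \<Longrightarrow> run D e w (of_bool (\<not> P (w ! 0) (drop 1 w)))" for w
    unfolding computable_in_def by auto
  from this[of "_ # _"] have e: "length v = k \<Longrightarrow> run D e (n # v) (of_bool (\<not> P n v))" for n v
    by simp
  have "run D (Mu e) v (LEAST n. P n v)" if "length v = k" for v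
  proof (rule run_Mu)
    show "run D e ((LEAST n. P n v) # v) 0"
      using e[OF that, of "LEAST n. P n v"] LeastI_ex[OF assms(2)[OF that]] by simp
    show "\<forall>m<(LEAST n. P n v). \<exists>y. run D e (m # v) (Suc y)"
    proof (intro allI impI)
      fix m assume "m < (LEAST n. P n v)"
      then show "\<exists>y. run D e (m # v) (Suc y)"
        using e[OF that, of m] not_less_Least[of m "\<lambda>n. P n v"] by auto
    qed
  qed
  then show ?thesis unfolding computable_in_def by blast
qed

section \<open>Arithmetic, Boolean operations and pairing\<close>

lemma computable_in_pred [computable_intros]:
  assumes "computable_in D k f"
  shows "computable_in D k (\<lambda>v. f v - 1)"
proof -
  have "computable_in D k (\<lambda>v. rec_nat 0 (\<lambda>m r. m) (f v))"
    by (intro computable_in_rec computable_intros assms) simp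
  moreover have "rec_nat 0 (\<lambda>m r. m) n = n - 1" for n :: nat by (cases n) auto
  ultimately show ?thesis by simp
qed

lemma computable_in_add [computable_intros]:
  assumes "computable_in D k f" "computable_in D k g"
  shows "computable_in D k (\<lambda>v. f v + g v)"
proof -
  have "computable_in D k (\<lambda>v. rec_nat (f v) (\<lambda>m r. Suc r) (g v))"
    by (intro computable_in_rec computable_intros assms) simp
  moreover have "rec_nat a (\<lambda>m r. Suc r) n = a + n" for a n by (induction n) auto
  ultimately show ?thesis by simp
qed

lemma computable_in_diff [computable_intros]:
  assumes "computable_in D k f" "computable_in D k g"
  shows "computable_in D k (\<lambda>v. f v - g v)"
proof -
  have "computable_in D k (\<lambda>v. rec_nat (f v) (\<lambda>m r. r - 1) (g v))"
    by (intro computable_in_rec computable_intros assms) simp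
  moreover have "rec_nat a (\<lambda>m r. r - 1) n = a - n" for a n :: nat by (induction n) auto
  ultimately show ?thesis by simp
qed

lemma computable_in_mult [computable_intros]:
  assumes "computable_in D k f" "computable_in D k g"
  shows "computable_in D k (\<lambda>v. f v * g v)"
proof (rule computable_in_comp2[OF _ assms])
  have "computable_in D 2 (\<lambda>v. rec_nat 0 (\<lambda>m r. r + v ! 0) (v ! 1))"
    by (intro computable_in_rec computable_intros) simp_all
  moreover have "rec_nat 0 (\<lambda>m r. r + a) n = a * n" for a n :: nat by (induction n) auto
  ultimately show "computable_in D 2 (\<lambda>v. v ! 0 * v ! 1)" by simp
qed

lemma computable_in_not [computable_intros]:
  assumes "computable_in D k (\<lambda>v. of_bool (P v))"
  shows "computable_in D k (\<lambda>v. of_bool (\<not> P v))"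
proof -
  have "computable_in D k (\<lambda>v. 1 - of_bool (P v))" by (intro computable_intros assms)
  then show ?thesis by (rule computable_in_cong) auto
qed

lemma computable_in_conj [computable_intros]:
  assumes "computable_in D k (\<lambda>v. of_bool (P v))" "computable_in D k (\<lambda>v. of_bool (Q v))"
  shows "computable_in D k (\<lambda>v. of_bool (P v \<and> Q v))"
proof -
  have "computable_in D k (\<lambda>v. of_bool (P v) * of_bool (Q v))" by (intro computable_intros assms)
  then show ?thesis by (rule computable_in_cong) auto
qed

lemma computable_in_disj [computable_intros]:
  assumes "computable_in D k (\<lambda>v. of_bool (P v))" "computable_in D k (\<lambda>v. of_bool (Q v))"
  shows "computable_in D k (\<lambda>v. of_bool (P v \<or> Q v))"
proof -
  have "computable_in D k (\<lambda>v. of_bool (\<not> (\<not> P v \<and> \<not> Q v)))" by (intro computable_intros assms)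
  then show ?thesis by (rule computable_in_cong) auto
qed

lemma computable_in_less [computable_intros]:
  assumes "computable_in D k f" "computable_in D k g"
  shows "computable_in D k (\<lambda>v. of_bool (f v < g v))"
proof -
  have "computable_in D k (\<lambda>v. 1 - (1 - (g v - f v)))" by (intro computable_intros assms)
  then show ?thesis by (rule computable_in_cong) auto
qed

lemma computable_in_eq [computable_intros]:
  assumes "computable_in D k f" "computable_in D k g"
  shows "computable_in D k (\<lambda>v. of_bool (f v = g v))"
proof -
  have "computable_in D k (\<lambda>v. of_bool (\<not> f v < g v \<and> \<not> g v < f v))"
    by (intro computable_intros assms)
  then show ?thesis by (rule computable_in_cong) auto
qed

lemma computable_in_if [computable_intros]:
  assumes "computable_in D k (\<lambda>v. of_bool (P v))" "computable_in D k f" "computable_in D k g"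
  shows "computable_in D k (\<lambda>v. if P v then f v else g v)"
proof -
  have "computable_in D k (\<lambda>v. of_bool (P v) * f v + of_bool (\<not> P v) * g v)"
    by (intro computable_intros assms)
  then show ?thesis by (rule computable_in_cong) auto
qed

lemma computable_in_fact [computable_intros]:
  assumes "computable_in D k f"
  shows "computable_in D k (\<lambda>v. fact (f v))"
proof -
  have "computable_in D k (\<lambda>v. rec_nat 1 (\<lambda>m r. Suc m * r) (f v))"
    by (intro computable_in_rec computable_intros assms) simp_all
  moreover have "rec_nat 1 (\<lambda>m r. Suc m * r) n = fact n" for n by (induction n) auto
  ultimately show ?thesis by simp
qed

lemma computable_in_mod_const [computable_intros]:
  assumes "computable_in D k f"
  shows "computable_in D k (\<lambda>v. f v mod N)"
proof -
  have "computable_in D k (\<lambda>v. rec_nat (0 mod N) (\<lambda>m r. if Suc r = N then 0 else Suc r) (f v))"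
    by (intro computable_in_rec computable_intros assms) simp_all
  moreover have "rec_nat (0 mod N) (\<lambda>m r. if Suc r = N then 0 else Suc r) n = n mod N" for n
    by (induction n) (auto simp: mod_Suc)
  ultimately show ?thesis by simp
qed

lemma computable_in_triangle [computable_intros]:
  assumes "computable_in D k f"
  shows "computable_in D k (\<lambda>v. triangle (f v))"
proof -
  have "computable_in D k (\<lambda>v. rec_nat 0 (\<lambda>m r. r + Suc m) (f v))"
    by (intro computable_in_rec computable_intros assms) simp_all
  moreover have "rec_nat 0 (\<lambda>m r. r + Suc m) n = triangle n" for n by (induction n) auto
  ultimately show ?thesis by simp
qed

lemma computable_in_prod_encode [computable_intros]:
  assumes "computable_in D k f" "computable_in D k g"
  shows "computable_in D k (\<lambda>v. prod_encode (f v, g v))"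
  unfolding prod_encode_def prod.case by (intro computable_intros assms)

text \<open>The diagonal \<open>a + b\<close> of the pairing function occupies the codes from
  \<open>triangle (a + b)\<close> to just below \<open>triangle (Suc (a + b))\<close>. An unbounded
  search for the diagonal thus computes the decoding.\<close>

lemma prod_decode_Least:
  defines "K \<equiv> \<lambda>p. LEAST j. p < triangle (Suc j)"
  shows "prod_decode p = (p - triangle (K p), K p - (p - triangle (K p)))"
proof -
  obtain a b where ab: "prod_decode p = (a, b)" by fastforce
  then have p: "p = triangle (a + b) + a"
    using prod_decode_inverse[of p] by (simp add: prod_encode_def)
  have "K p = a + b" unfolding K_def
  proof (rule Least_equality)
    fix j assume "p < triangle (Suc j)"
    then have less: "triangle (a + b) < triangle (Suc j)" using p by auto
    show "a + b \<le> j"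
    proof (rule ccontr)
      assume "\<not> a + b \<le> j"
      then have "Suc j \<le> a + b" by simp
      then have "triangle (Suc j) \<le> triangle (a + b)"
        by (induction rule: dec_induct) auto
      with less show False by simp
    qed
  qed (use p in auto)
  with ab p show ?thesis by simp
qed

lemma computable_in_prod_decode:
  assumes "computable_in D k f"
  shows computable_in_fst_prod_decode: "computable_in D k (\<lambda>v. fst (prod_decode (f v)))"
    and computable_in_snd_prod_decode: "computable_in D k (\<lambda>v. snd (prod_decode (f v)))"
proof -
  have "\<exists>j. p < triangle (Suc j)" for p
    by (rule exI[of _ p]) (auto simp: triangle_def)
  then have K: "computable_in D 1
      (\<lambda>v. LEAST j. v ! 0 < triangle (Suc j))"
    by (intro computable_in_Least computable_intros) simp_all
  note K' = computable_in_comp1[OF K assms]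
  show "computable_in D k (\<lambda>v. fst (prod_decode (f v)))"
    unfolding prod_decode_Least fst_conv by (intro computable_intros assms K')
  show "computable_in D k (\<lambda>v. snd (prod_decode (f v)))"
    unfolding prod_decode_Least snd_conv by (intro computable_intros assms K')
qed

lemmas [computable_intros] = computable_in_fst_prod_decode computable_in_snd_prod_decode

text \<open>On string codes, \<open>string_query t\<close> represents the string as a partial oracle: the value is \<open>0\<close>
  where it is undefined, and the successor of the bit elsewhere. On any other number it is still
  a partial oracle.\<close>

definition string_query :: "nat \<Rightarrow> nat \<Rightarrow> nat" where
  "string_query t i = (let d = rec_nat t (\<lambda>_ r. snd (prod_decode (r - 1))) i
    in if d = 0 then 0 else Suc (of_bool (\<not> fst (prod_decode (d - 1)) = 0)))"

lemma computable_in_string_query [computable_intros]: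
  assumes "computable_in D k f" "computable_in D k g"
  shows "computable_in D k (\<lambda>v. string_query (f v) (g v))"
proof -
  have "computable_in D k (\<lambda>v. rec_nat (f v) (\<lambda>_ r. snd (prod_decode (r - 1))) (g v))"
    by (intro computable_in_rec computable_intros assms) simp
  then show ?thesis unfolding string_query_def Let_def by (intro computable_intros)
qed

definition approx :: "nat set \<Rightarrow> nat \<Rightarrow> nat \<Rightarrow> nat" where
  "approx D s i = (if i < s then Suc (of_bool (i \<in> D)) else 0)"

lemma string_query_initial_segment:
  "string_query (string_code (initial_segment D s)) = approx D s"
proof
  fix i
  \<comment> \<open>The iteration takes tails of the coded list. As
    \<open>prod_decode 0 = (0, 0)\<close>, the code \<open>0\<close> of the empty list is a fixed
    point, so positions past the end count as undefined.\<close>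
  have tl: "rec_nat (list_encode xs) (\<lambda>_ r. snd (prod_decode (r - 1))) i = list_encode (drop i xs)"
    for xs
  proof (induction i)
    case (Suc i)
    show ?case
    proof (cases "i < length xs")
      case True
      then show ?thesis using Suc by (simp add: Cons_nth_drop_Suc[symmetric])
    next
      case False
      then show ?thesis using Suc by (simp add: prod_decode_def prod_decode_aux.simps)
    qed
  qed simp
  show "string_query (string_code (initial_segment D s)) i = approx D s i"
  proof (cases "i < s")
    case True
    then have "drop i (map of_bool (initial_segment D s))
        = (of_bool (i \<in> D) :: nat) # map (\<lambda>j. of_bool (j \<in> D)) [Suc i..<s]"
      unfolding initial_segment_def by (simp add: drop_map) (simp add: upt_conv_Cons)
    with True show ?thesis
      unfolding string_query_def string_code_def tl approx_def by (simp add: Let_def)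
  next
    case False
    then show ?thesis
      unfolding string_query_def string_code_def tl approx_def initial_segment_def by simp
  qed
qed


section \<open>Evaluation with bounded search\<close>

text \<open>The state is \<open>0\<close> while searching, \<open>1\<close> after meeting an
  undefined value, and \<open>Suc (Suc n)\<close> once \<open>n\<close> is found. Subtracting 1
  merges both kinds of failure into the undefined value \<open>0\<close>. Values of \<open>F\<close>
  are shifted too: \<open>0\<close> is undefined and \<open>1\<close> is the output zero.\<close>

definition bounded_mu :: "(nat \<Rightarrow> nat) \<Rightarrow> nat \<Rightarrow> nat" where
  "bounded_mu F s = rec_nat 0 (\<lambda>n r. if r = 0
    then (if F n = 0 then 1 else if F n = 1 then Suc (Suc n) else 0) else r) s"

lemma bounded_mu_eq_0_iff: "bounded_mu F s = 0 \<longleftrightarrow> (\<forall>m<s. 2 \<le> F m)"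
  unfolding bounded_mu_def by (induction s) (auto simp: less_Suc_eq)

lemma bounded_mu_eq_iff:
  "bounded_mu F s = Suc (Suc n) \<longleftrightarrow> n < s \<and> F n = 1 \<and> (\<forall>m<n. 2 \<le> F m)"
proof (induction s)
  case 0
  then show ?case by (simp add: bounded_mu_def)
next
  case (Suc s)
  have step: "bounded_mu F (Suc s) = (if bounded_mu F s = 0
    then (if F s = 0 then 1 else if F s = 1 then Suc (Suc s) else 0) else bounded_mu F s)"
    by (simp add: bounded_mu_def)
  show ?case
  proof (cases "bounded_mu F s = 0")
    case True
    then have "\<forall>m<s. 2 \<le> F m" by (simp add: bounded_mu_eq_0_iff)
    with True show ?thesis unfolding step by (auto simp: less_Suc_eq)
  next
    case False
    then obtain m where "m < s" "F m < 2" by (auto simp: bounded_mu_eq_0_iff not_le)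
    with False Suc show ?thesis unfolding step
      by (auto simp: less_Suc_eq)
  qed
qed

text \<open>The output \<open>0\<close> means that the computation is undefined, and \<open>Suc y\<close> that it returns \<open>y\<close>.
  The bound \<open>s\<close> applies to minimisation only: all other constructors terminate by themselves.\<close>

fun ev :: "functional \<Rightarrow> nat \<Rightarrow> (nat \<Rightarrow> nat) \<Rightarrow> nat list \<Rightarrow> nat" where
  "ev Zero s q xs = 1"
| "ev Succ s q xs = (if length xs = 1 then Suc (Suc (hd xs)) else 0)"
| "ev (Proj i) s q xs = (if i < length xs then Suc (xs ! i) else 0)"
| "ev Query s q xs = (if length xs = 1 then q (hd xs) else 0)"
| "ev (Comp f gs) s q xs = (let rs = map (\<lambda>g. ev g s q xs) gs
    in if 0 \<in> set rs then 0 else ev f s q (map (\<lambda>r. r - 1) rs))"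
| "ev (Rec f g) s q xs = (case xs of [] \<Rightarrow> 0 | n # ys \<Rightarrow>
    rec_nat (ev f s q ys) (\<lambda>m r. if r = 0 then 0 else ev g s q (m # (r - 1) # ys)) n)"
| "ev (Mu f) s q xs = bounded_mu (\<lambda>n. ev f s q (n # xs)) s - 1"

lemma ev_Comp:
  "(\<And>g. g \<in> set gs \<Longrightarrow> ev g s q xs \<noteq> 0) \<Longrightarrow>
    ev (Comp f gs) s q xs = ev f s q (map (\<lambda>g. ev g s q xs - 1) gs)"
  by (force simp: Let_def comp_def)

lemma ev_MuE:
  assumes "ev (Mu f) s q xs = Suc n"
  shows "n < s" "ev f s q (n # xs) = 1" "\<And>m. m < n \<Longrightarrow> 2 \<le> ev f s q (m # xs)"
proof -
  from assms have "bounded_mu (\<lambda>n. ev f s q (n # xs)) s = Suc (Suc n)" by simp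
  then show "n < s" "ev f s q (n # xs) = 1" "\<And>m. m < n \<Longrightarrow> 2 \<le> ev f s q (m # xs)"
    unfolding bounded_mu_eq_iff by auto
qed

lemma ev_MuI:
  assumes "n < s" "ev f s q (n # xs) = 1" "\<And>m. m < n \<Longrightarrow> 2 \<le> ev f s q (m # xs)"
  shows "ev (Mu f) s q xs = Suc n"
proof -
  from assms have "bounded_mu (\<lambda>n. ev f s q (n # xs)) s = Suc (Suc n)"
    unfolding bounded_mu_eq_iff by auto
  then show ?thesis by simp
qed

section \<open>Soundness, monotonicity and completeness of the evaluation\<close>

definition suboracle :: "(nat \<Rightarrow> nat) \<Rightarrow> (nat \<Rightarrow> nat) \<Rightarrow> bool" where
  "suboracle q q' \<longleftrightarrow> (\<forall>i. q i \<noteq> 0 \<longrightarrow> q' i = q i)"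

definition total_oracle :: "nat set \<Rightarrow> nat \<Rightarrow> nat" where
  "total_oracle D i = Suc (of_bool (i \<in> D))"

lemma suboracle_approx: "s \<le> s' \<Longrightarrow> suboracle (approx D s) (approx D s')"
  by (auto simp: suboracle_def approx_def)

text \<open>Every answer given by \<open>q\<close> is correct for \<open>D\<close>, so a defined
  value comes from a genuine computation. Arbitrary partial oracles are allowed because guessed
  oracles are evaluated later.\<close>

lemma ev_imp_run:
  assumes "suboracle q (total_oracle D)"
  shows "ev e s q xs = Suc y \<Longrightarrow> run D e xs y"
proof (induction e arbitrary: xs y)
  case Zero
  then show ?case by (auto intro: run_Zero)
next
  case Succ
  then show ?case by (cases xs) (auto intro: run_Succ split: if_splits)
next
  case (Proj i)
  then show ?case by (auto intro: run_Proj split: if_splits)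
next
  case Query
  then obtain x where x: "xs = [x]" "q x = Suc y" by (cases xs) (auto split: if_splits)
  with assms have "y = of_bool (x \<in> D)"
    unfolding suboracle_def total_oracle_def by (metis nat.inject nat.distinct(1))
  with x show ?case using run_Query[of D x] by simp
next
  case (Comp f gs)
  let ?ys = "map (\<lambda>g. ev g s q xs - 1) gs"
  from Comp.prems have nz: "\<And>g. g \<in> set gs \<Longrightarrow> ev g s q xs \<noteq> 0" and f: "ev f s q ?ys = Suc y"
    by (auto simp: Let_def comp_def split: if_splits)
  have "list_all2 (\<lambda>g. run D g xs) gs ?ys"
    unfolding list_all2_conv_all_nth
    by (auto intro!: Comp.IH(2)) (metis nz nth_mem Suc_diff_1 not_gr0 One_nat_def)
  then show ?case using Comp.IH(1)[OF f] by (rule run_Comp)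
next
  case (Rec f g)
  from Rec.prems obtain n ys where xs: "xs = n # ys" by (cases xs) auto
  have "ev (Rec f g) s q (n # ys) = Suc y \<Longrightarrow> run D (Rec f g) (n # ys) y" for n y
  proof (induction n arbitrary: y)
    case 0
    then show ?case using Rec.IH(1)[of ys y] by (auto intro: run_Rec_0)
  next
    case (Suc n)
    then obtain r where r: "ev (Rec f g) s q (n # ys) = Suc r"
      by (cases "ev (Rec f g) s q (n # ys)") auto
    with Suc.prems have "ev g s q (n # r # ys) = Suc y" by simp
    from run_Rec_Suc[OF Suc.IH[OF r] Rec.IH(2)[OF this]] show ?case .
  qed
  with Rec.prems xs show ?case by blast
next
  case (Mu f)
  note mu = ev_MuE[OF Mu.prems]
  show ?case
  proof (rule run_Mu)
    show "run D f (y # xs) 0" using Mu.IH mu(2) by simp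
    show "\<forall>m<y. \<exists>z. run D f (m # xs) (Suc z)"
    proof (intro allI impI)
      fix m assume "m < y"
      from mu(3)[OF this] obtain z where "ev f s q (m # xs) = Suc (Suc z)"
        by (metis add_2_eq_Suc le_Suc_ex)
      then show "\<exists>z. run D f (m # xs) (Suc z)" using Mu.IH by blast
    qed
  qed
qed

text \<open>A defined value rests only on defined subcomputations, and a successful search has met
  its first zero below \<open>s\<close>. More answers and a larger bound change neither.\<close>

lemma ev_mono:
  assumes "suboracle q q'" "s \<le> s'"
  shows "ev e s q xs = Suc y \<Longrightarrow> ev e s' q' xs = Suc y"
proof (induction e arbitrary: xs y)
  case Query
  then show ?case using assms by (auto simp: suboracle_def split: if_splits)
next
  case (Comp f gs)
  from Comp.prems have nz: "\<And>g. g \<in> set gs \<Longrightarrow> ev g s q xs \<noteq> 0"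
    and f: "ev f s q (map (\<lambda>g. ev g s q xs - 1) gs) = Suc y"
    by (auto simp: Let_def comp_def split: if_splits)
  have eq: "ev g s' q' xs = ev g s q xs" if "g \<in> set gs" for g
    using Comp.IH(2)[OF that] nz[OF that] by (metis not0_implies_Suc)
  then have "ev (Comp f gs) s' q' xs = ev f s' q' (map (\<lambda>g. ev g s' q' xs - 1) gs)"
    using nz by (intro ev_Comp) auto
  also have "map (\<lambda>g. ev g s' q' xs - 1) gs = map (\<lambda>g. ev g s q xs - 1) gs" using eq by simp
  finally show ?case using Comp.IH(1)[OF f] by simp
next
  case (Rec f g)
  from Rec.prems obtain n ys where xs: "xs = n # ys" by (cases xs) auto
  have "ev (Rec f g) s q (n # ys) = Suc y \<Longrightarrow> ev (Rec f g) s' q' (n # ys) = Suc y" for n y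
  proof (induction n arbitrary: y)
    case 0
    then show ?case using Rec.IH(1)[of ys y] by simp
  next
    case (Suc n)
    then obtain r where r: "ev (Rec f g) s q (n # ys) = Suc r"
      by (cases "ev (Rec f g) s q (n # ys)") auto
    with Suc.prems have "ev g s q (n # r # ys) = Suc y" by simp
    with Suc.IH[OF r] Rec.IH(2) show ?case by simp
  qed
  with Rec.prems xs show ?case by blast
next
  case (Mu f)
  note mu = ev_MuE[OF Mu.prems]
  show ?case
  proof (rule ev_MuI)
    show "y < s'" using mu(1) assms(2) by simp
    show "ev f s' q' (y # xs) = 1" using Mu.IH mu(2) by simp
    fix m assume "m < y"
    from mu(3)[OF this] obtain z where "ev f s q (m # xs) = Suc (Suc z)"
      by (metis add_2_eq_Suc le_Suc_ex)
    then show "2 \<le> ev f s' q' (m # xs)" using Mu.IH by simp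
  qed
qed (auto split: if_splits)

lemma ev_approx_mono:
  "ev e s (approx D s) xs = Suc y \<Longrightarrow> s \<le> s' \<Longrightarrow> ev e s' (approx D s') xs = Suc y"
  using ev_mono[OF suboracle_approx] by blast

text \<open>A halting computation has finitely many subcomputations, so by monotonicity one number
  bounds all its searches and queries.\<close>

lemma run_imp_ev:
  "run D e xs y \<Longrightarrow> \<exists>s. ev e s (approx D s) xs = Suc y"
proof (induction rule: run.induct)
  case (run_Query x)
  have "ev Query (Suc x) (approx D (Suc x)) [x] = Suc (of_bool (x \<in> D))" by (simp add: approx_def)
  then show ?case by blast
next
  case (run_Comp xs gs ys f z)
  from run_Comp.IH(2) obtain s0 where s0: "ev f s0 (approx D s0) ys = Suc z" by blast
  have "\<forall>i<length gs. \<exists>s. ev (gs ! i) s (approx D s) xs = Suc (ys ! i)"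
    using run_Comp.IH(1) by (auto simp: list_all2_conv_all_nth)
  then obtain S where S: "i < length gs \<Longrightarrow> ev (gs ! i) (S i) (approx D (S i)) xs = Suc (ys ! i)"
    for i by metis
  define s where "s = Max (insert s0 (S ` {..<length gs}))"
  have s: "s0 \<le> s" "i < length gs \<Longrightarrow> S i \<le> s" for i unfolding s_def by auto
  have len: "length ys = length gs" using run_Comp.IH(1) by (simp add: list_all2_lengthD)
  have "map (\<lambda>g. ev g s (approx D s) xs) gs = map Suc ys"
  proof (rule nth_equalityI)
    fix i assume "i < length (map (\<lambda>g. ev g s (approx D s) xs) gs)"
    then show "map (\<lambda>g. ev g s (approx D s) xs) gs ! i = map Suc ys ! i"
      using ev_approx_mono[OF S, of i s] s len by simp
  qed (simp add: len)
  then have "ev (Comp f gs) s (approx D s) xs = ev f s (approx D s) ys"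
    by (simp add: Let_def comp_def)
  also have "\<dots> = Suc z" using s(1) by (rule ev_approx_mono[OF s0])
  finally show ?case by blast
next
  case (run_Rec_0 f xs y g)
  then show ?case by auto
next
  case (run_Rec_Suc f g n xs r y)
  then obtain s0 s1 where s: "ev (Rec f g) s0 (approx D s0) (n # xs) = Suc r"
    "ev g s1 (approx D s1) (n # r # xs) = Suc y" by blast
  let ?s = "max s0 s1"
  have "ev (Rec f g) ?s (approx D ?s) (n # xs) = Suc r"
    by (rule ev_approx_mono[OF s(1)]) simp
  moreover have "ev g ?s (approx D ?s) (n # r # xs) = Suc y"
    by (rule ev_approx_mono[OF s(2)]) simp
  ultimately have "ev (Rec f g) ?s (approx D ?s) (Suc n # xs) = Suc y" by simp
  then show ?case by blast
next
  case (run_Mu f n xs)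
  then obtain s0 where s0: "ev f s0 (approx D s0) (n # xs) = Suc 0" by blast
  from run_Mu have "\<forall>m<n. \<exists>s y. ev f s (approx D s) (m # xs) = Suc (Suc y)" by blast
  then obtain S Y where S: "m < n \<Longrightarrow> ev f (S m) (approx D (S m)) (m # xs) = Suc (Suc (Y m))"
    for m by metis
  \<comment> \<open>\<open>Suc n\<close> is included because the search below \<open>s\<close> has
    to reach \<open>n\<close> itself.\<close>
  define s where "s = Max (insert (Suc n) (insert s0 (S ` {..<n})))"
  have "Suc n \<le> s" and s': "s0 \<le> s" "m < n \<Longrightarrow> S m \<le> s" for m
    unfolding s_def by (intro Max_ge; simp)+
  then have s: "n < s" by simp
  have "ev (Mu f) s (approx D s) xs = Suc n"
  proof (rule ev_MuI)
    show "ev f s (approx D s) (n # xs) = 1"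
      using ev_approx_mono[OF s0] s' by simp
    show "2 \<le> ev f s (approx D s) (m # xs)" if "m < n" for m
      using ev_approx_mono[OF S[OF that]] s' that by simp
  qed (rule s)
  then show ?case by blast
qed auto

text \<open>The use principle: \<open>approx D s\<close> is undefined from \<open>s\<close> on, so
  the bound of the evaluation also bounds the queries.\<close>

lemma run_use:
  assumes "run D e xs y"
  obtains u where "\<And>D'. (\<And>i. i < u \<Longrightarrow> i \<in> D' \<longleftrightarrow> i \<in> D) \<Longrightarrow> run D' e xs y"
proof -
  from run_imp_ev[OF assms] obtain s where s: "ev e s (approx D s) xs = Suc y" by blast
  show ?thesis
  proof (rule that)
    fix D' assume "\<And>i. i < s \<Longrightarrow> i \<in> D' \<longleftrightarrow> i \<in> D"
    then have "suboracle (approx D s) (total_oracle D')"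
      by (auto simp: suboracle_def approx_def total_oracle_def)
    then show "run D' e xs y" using s by (rule ev_imp_run)
  qed
qed

section \<open>Computability of evaluation, and computably enumerable sets of strings\<close>

lemma computable_in_bounded_mu [computable_intros]:
  assumes "computable_in D (Suc (Suc k)) (\<lambda>w. F (drop 2 w) (w ! 0))" "computable_in D k s"
  shows "computable_in D k (\<lambda>v. bounded_mu (F v) (s v))"
  unfolding bounded_mu_def
  by (intro computable_in_rec computable_intros assms) (simp_all add: assms[simplified])

text \<open>The functional \<open>e\<close> is fixed and its searches are bounded, so induction on
  \<open>e\<close> reduces evaluation to primitive recursion. \<open>Q\<close> is a computable
  family of partial oracles whose index \<open>t\<close> may vary, which later allows searching
  through guesses.\<close>

lemma computable_in_ev:
  assumes Q: "computable_in D 2 (\<lambda>v. Q (v ! 0) (v ! 1))"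
    and "computable_in D k s" "computable_in D k t"
    and "\<And>g. g \<in> set gs \<Longrightarrow> computable_in D k g"
  shows "computable_in D k (\<lambda>v. ev e (s v) (Q (t v)) (map (\<lambda>g. g v) gs))"
  using assms(2-)
proof (induction e arbitrary: k s t gs)
  case Zero
  then show ?case by (auto intro: computable_intros)
next
  case Succ
  show ?case
  proof (cases "length gs = 1")
    case True
    then obtain g where "gs = [g]" by (cases gs) auto
    with Succ show ?thesis by (auto intro!: computable_intros)
  qed (auto intro: computable_intros)
next
  case (Proj i)
  then show ?case by (cases "i < length gs") (auto intro: computable_intros)
next
  case Query
  show ?case
  proof (cases "length gs = 1")
    case True
    then obtain g where "gs = [g]" by (cases gs) auto
    with Query show ?thesis by (auto intro!: computable_in_comp2[OF Q])
  qed (auto intro: computable_intros)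
next
  case (Comp f hs)
  let ?r = "\<lambda>h v. ev h (s v) (Q (t v)) (map (\<lambda>g. g v) gs)"
  have r: "computable_in D k (?r h)" if "h \<in> set hs" for h
    using Comp.IH(2)[OF that Comp.prems] .
  have nz: "set hs' \<subseteq> set hs \<Longrightarrow>
    computable_in D k (\<lambda>v. of_bool (\<not> 0 \<in> set (map (\<lambda>h. ?r h v) hs')))" for hs'
  proof (induction hs')
    case (Cons h hs')
    from Cons.prems have "computable_in D k (\<lambda>v. of_bool (\<not> 0 = ?r h v))"
      by (intro computable_intros r) auto
    from computable_in_conj[OF this Cons.IH] Cons.prems show ?case by simp
  qed (auto intro: computable_intros)
  have "computable_in D k (\<lambda>v. ev f (s v) (Q (t v)) (map (\<lambda>g. g v) (map (\<lambda>h v. ?r h v - 1) hs)))"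
    by (rule Comp.IH(1)[OF Comp.prems(1,2)]) (auto intro: computable_intros r)
  from computable_in_if[OF nz[OF order.refl] this computable_in_const[of D k 0]]
  show ?case by (rule computable_in_cong) (auto simp: Let_def comp_def)
next
  case (Rec f g)
  show ?case
  proof (cases gs)
    case Nil
    then show ?thesis by (auto intro: computable_intros)
  next
    case (Cons n hs)
    \<comment> \<open>The recursion carries shifted values, so the previous result is passed on as
      \<open>w ! 1 - 1\<close>.\<close>
    let ?hs = "(\<lambda>w. w ! 0) # (\<lambda>w. w ! 1 - 1) # map (\<lambda>h w. h (drop 2 w)) hs"
    have "computable_in D (Suc (Suc k))
        (\<lambda>w. ev g (s (drop 2 w)) (Q (t (drop 2 w))) (map (\<lambda>g. g w) ?hs))"
      using Rec.prems Cons
      by (intro Rec.IH(2)) (auto intro!: computable_intros intro: computable_in_drop2)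
    then have "computable_in D (Suc (Suc k)) (\<lambda>w. ev g (s (drop 2 w)) (Q (t (drop 2 w)))
        (w ! 0 # (w ! 1 - 1) # map (\<lambda>h. h (drop 2 w)) hs))"
      by (simp add: comp_def)
    then have "computable_in D k (\<lambda>v. rec_nat (ev f (s v) (Q (t v)) (map (\<lambda>h. h v) hs))
        (\<lambda>m r. if r = 0 then 0 else ev g (s v) (Q (t v)) (m # (r - 1) # map (\<lambda>h. h v) hs)) (n v))"
      using Rec.prems Cons
      by (intro computable_in_rec computable_intros Rec.IH(1)) simp_all
    then show ?thesis using Cons by simp
  qed
next
  case (Mu f)
  let ?gs = "(\<lambda>w. w ! 0) # map (\<lambda>h w. h (drop 2 w)) gs"
  have "computable_in D (Suc (Suc k))
      (\<lambda>w. ev f (s (drop 2 w)) (Q (t (drop 2 w))) (map (\<lambda>g. g w) ?gs))"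
    using Mu.prems by (intro Mu.IH) (auto intro!: computable_intros intro: computable_in_drop2)
  then have "computable_in D k
      (\<lambda>v. bounded_mu (\<lambda>n. ev f (s v) (Q (t v)) (n # map (\<lambda>h. h v) gs)) (s v))"
    using Mu.prems by (intro computable_intros) (simp_all add: comp_def)
  then show ?case unfolding ev.simps by (rule computable_in_pred)
qed

lemma computable_in_ev1:
  assumes "computable_in D 2 (\<lambda>v. Q (v ! 0) (v ! 1))"
    and "computable_in D k s" "computable_in D k t" "computable_in D k g"
  shows "computable_in D k (\<lambda>v. ev e (s v) (Q (t v)) [g v])"
  using computable_in_ev[of D Q k s t "[g]" e] assms by simp

text \<open>Serves majority votes, and also bounded quantifiers: a universal statement holds if the
  number of counterexamples is \<open>0\<close>.\<close>

lemma computable_in_card [computable_intros]: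
  assumes "computable_in D (Suc (Suc k)) (\<lambda>w. of_bool (P (w ! 0) (drop 2 w)))"
    and "computable_in D k n"
  shows "computable_in D k (\<lambda>v. card {i. i < n v \<and> P i v})"
proof -
  have "computable_in D k (\<lambda>v. rec_nat 0 (\<lambda>m r. r + of_bool (P m v)) (n v))"
    by (intro computable_in_rec computable_intros assms) simp
  moreover have "rec_nat 0 (\<lambda>m r. r + of_bool (P m v)) n = card {i. i < n \<and> P i v}" for n v
  proof (induction n)
    case (Suc n)
    have "{i. i < Suc n \<and> P i v} = {i. i < n \<and> P i v} \<union> (if P n v then {n} else {})"
      by (auto simp: less_Suc_eq)
    then show ?case using Suc by (simp add: card_insert_if)
  qed simp
  ultimately show ?thesis by simp
qed

text \<open>Since \<open>P\<close> is decidable, minimisation over the witness halts exactly when a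
  witness exists.\<close>

lemma ce_stringsI:
  assumes "computable_in {} 2 (\<lambda>v. of_bool (P (v ! 0) (v ! 1)))"
  shows "ce_strings {\<sigma>. \<exists>w. P w (string_code \<sigma>)}"
proof -
  from computable_in_not[OF assms] obtain e where
    "length v = 2 \<Longrightarrow> run {} e v (of_bool (\<not> P (v ! 0) (v ! 1)))" for v
    unfolding computable_in_def by auto
  from this[of "[_, _]"] have e: "run {} e [w, c] (of_bool (\<not> P w c))" for w c by simp
  have "(\<exists>w. P w c) \<longleftrightarrow> (\<exists>y. run {} (Mu e) [c] y)" for c
  proof
    assume ex: "\<exists>w. P w c"
    have "run {} (Mu e) [c] (LEAST w. P w c)"
    proof (rule run_Mu)
      show "run {} e [LEAST w. P w c, c] 0"
        using e[of "LEAST w. P w c" c] LeastI_ex[OF ex] by simp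
      show "\<forall>m<(LEAST w. P w c). \<exists>y. run {} e [m, c] (Suc y)"
      proof (intro allI impI)
        fix m assume "m < (LEAST w. P w c)"
        then show "\<exists>y. run {} e [m, c] (Suc y)"
          using e[of m c] not_less_Least[of m "\<lambda>w. P w c"] by auto
      qed
    qed
    then show "\<exists>y. run {} (Mu e) [c] y" by blast
  next
    assume "\<exists>y. run {} (Mu e) [c] y"
    then obtain y where "run {} e [y, c] 0" by (auto elim: run_MuE)
    from run_deterministic[OF this e] have "P y c" by simp
    then show "\<exists>w. P w c" ..
  qed
  then show ?thesis unfolding ce_strings_def by blast
qed


section \<open>Turing reducibility\<close>

lemma turing_le_finite: "finite F \<Longrightarrow> F \<le>\<^sub>T D"
  unfolding turing_le_iff
proof (induction rule: finite_induct)
  case empty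
  show ?case unfolding empty_iff by (rule computable_in_const)
next
  case (insert x F)
  then show ?case unfolding insert_iff by (intro computable_intros) simp_all
qed

lemma turing_le_Diff: "A \<le>\<^sub>T D \<Longrightarrow> B \<le>\<^sub>T D \<Longrightarrow> A - B \<le>\<^sub>T D"
  unfolding turing_le_iff Diff_iff by (intro computable_intros)

lemma turing_le_Un: "A \<le>\<^sub>T D \<Longrightarrow> B \<le>\<^sub>T D \<Longrightarrow> A \<union> B \<le>\<^sub>T D"
  unfolding turing_le_iff Un_iff by (intro computable_intros)

lemma turing_le_refl: "D \<le>\<^sub>T D"
  unfolding turing_le_iff by (intro computable_intros) simp

lemma turing_le_if_eq_above:
  assumes "A \<le>\<^sub>T D" "\<And>i. m \<le> i \<Longrightarrow> i \<in> A \<longleftrightarrow> i \<in> B"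
  shows "B \<le>\<^sub>T D"
proof -
  have "B = (A - {..<m}) \<union> (B \<inter> {..<m})"
  proof (rule set_eqI)
    show "i \<in> B \<longleftrightarrow> i \<in> (A - {..<m}) \<union> (B \<inter> {..<m})" for i
      using assms(2)[of i] by (cases "m \<le> i") auto
  qed
  moreover have "(A - {..<m}) \<union> (B \<inter> {..<m}) \<le>\<^sub>T D"
    by (intro turing_le_Un turing_le_Diff turing_le_finite assms(1)) simp_all
  ultimately show ?thesis by simp
qed

text \<open>The search runs over all guesses for the oracle on \<open>R\<close>, since each of them gives a correct answer.\<close>

lemma turing_le_search:
  assumes R: "R \<le>\<^sub>T E" and B: "B - R \<le>\<^sub>T E"
    and halts: "\<And>n. \<exists>Z y. Z - R = B - R \<and> run Z e [n] y"
    and correct: "\<And>Z n y. Z - R = B - R \<Longrightarrow> run Z e [n] y \<Longrightarrow> y = of_bool (n \<in> A)"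
  shows "A \<le>\<^sub>T E"
proof -
  \<comment> \<open>Queries in \<open>R\<close> are answered by the guessed string \<open>t\<close>,
    all others by the true \<open>B\<close>. The search variable \<open>w\<close> below codes a
    bound together with a guess.\<close>
  define Q where "Q t i = (if i \<in> R then string_query t i else Suc (of_bool (i \<in> B - R)))" for t i
  define val where "val w n = ev e (fst (prod_decode w)) (Q (snd (prod_decode w))) [n]" for w n
  have "computable_in E 2 (\<lambda>v. Q (v ! 0) (v ! 1))"
    unfolding Q_def by (intro computable_intros computable_in_mem[OF R] computable_in_mem[OF B]) simp_all
  note Q = computable_in_ev1[where Q = Q, OF this]
  have val: "computable_in E k (\<lambda>v. val (f v) (g v))"
    if "computable_in E k f" "computable_in E k g" for k f g
    unfolding val_def by (intro Q computable_intros that)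
  have ex: "\<exists>w. \<not> val w n = 0" for n
  proof -
    from halts[of n] obtain Z y where Z: "Z - R = B - R" "run Z e [n] y" by metis
    from run_imp_ev[OF Z(2)] obtain s where s: "ev e s (approx Z s) [n] = Suc y" ..
    \<comment> \<open>A string read off a halting oracle \<open>Z\<close> is a successful guess, as
      \<open>Z\<close> agrees with \<open>B\<close> outside \<open>R\<close>.\<close>
    have "suboracle (approx Z s) (Q (string_code (initial_segment Z s)))"
      using Z(1) unfolding suboracle_def Q_def string_query_initial_segment
      by (auto simp: approx_def)
    from ev_mono[OF this order.refl s] have "\<not> val (prod_encode (s, string_code (initial_segment Z s))) n = 0"
      unfolding val_def by simp
    then show ?thesis ..
  qed
  have val_correct: "y = of_bool (n \<in> A)" if "val w n = Suc y" for w n y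
  proof (rule correct)
    let ?t = "snd (prod_decode w)"
    \<comment> \<open>The value \<open>2\<close> is the answer "yes". Undefined positions are
      completed by "no", which turns any guess into a set agreeing with \<open>B\<close> outside
      \<open>R\<close>.\<close>
    let ?Z = "{i. Q ?t i = 2}"
    show "?Z - R = B - R" by (auto simp: Q_def)
    have "suboracle (Q ?t) (total_oracle ?Z)"
      by (auto simp: suboracle_def total_oracle_def Q_def string_query_def Let_def split: if_splits)
    with that show "run ?Z e [n] y" unfolding val_def by (intro ev_imp_run)
  qed
  let ?w = "\<lambda>n. LEAST w. \<not> val w n = 0"
  have "computable_in E 1 (\<lambda>v. ?w (v ! 0))"
    by (intro computable_in_Least computable_intros val ex) simp_all
  then have "computable_in E 1 (\<lambda>v. val (?w (v ! 0)) (v ! 0) - 1)"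
    by (intro computable_intros val) simp_all
  moreover have "val (?w n) n - 1 = of_bool (n \<in> A)" for n
  proof -
    obtain y where "val (?w n) n = Suc y" using LeastI_ex[OF ex[of n]] not0_implies_Suc by blast
    with val_correct show ?thesis by simp
  qed
  ultimately show ?thesis unfolding turing_le_iff by simp
qed

text \<open>The search with nothing to guess: for empty \<open>R\<close> all queries to
  \<open>B\<close> are answered from \<open>C\<close>.\<close>

lemma turing_le_trans:
  assumes "A \<le>\<^sub>T B" "B \<le>\<^sub>T C"
  shows "A \<le>\<^sub>T C"
proof -
  from assms(1) obtain e where "run B e [n] (of_bool (n \<in> A))" for n
    unfolding turing_le_def computes_def by blast
  note e = this
  show ?thesis
  proof (rule turing_le_search[of "{}" C B e])
    show "B - {} \<le>\<^sub>T C" using assms(2) by simp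
    show "\<exists>Z y. Z - {} = B - {} \<and> run Z e [n] y" for n by (rule exI, rule exI, rule conjI[OF refl e])
    show "y = of_bool (n \<in> A)" if "Z - {} = B - {}" "run Z e [n] y" for Z n y
      using that e run_deterministic by simp
  qed (simp add: turing_le_finite)
qed

lemma computable_turing_le: "computable A \<Longrightarrow> A \<le>\<^sub>T D"
  unfolding computable_def using turing_le_trans turing_le_finite by blast


section \<open>Generic sets\<close>

lemma prefix_initial_segment:
  assumes "m \<le> n" "\<And>i. i < m \<Longrightarrow> i \<in> Y \<longleftrightarrow> i \<in> X"
  shows "prefix (initial_segment X m) (initial_segment Y n)"
proof -
  have "initial_segment Y n = initial_segment X m @ map (\<lambda>i. i \<in> Y) [m..<n]"
    using assms upt_add_eq_append[of 0 m "n - m"] by (simp add: initial_segment_def)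
  then show ?thesis by simp
qed

text \<open>The argument that the halves of a generic set form a minimal pair, relative to the common
  part of the two oracles: beyond some initial segment of \<open>X\<close> no string makes the two functionals
  disagree, so every halting computation of the first one, with guessed oracle on \<open>R2\<close>, agrees
  with the second one on the true oracle.\<close>

lemma one_generic_turing_le_Diff_Un:
  assumes gen: "one_generic X" and comp: "computable R1" "computable R2" and disj: "R1 \<inter> R2 = {}"
    and A: "A \<le>\<^sub>T X - R1" "A \<le>\<^sub>T X - R2"
  shows "A \<le>\<^sub>T X - (R1 \<union> R2)"
proof -
  from A obtain e1 e2 where e1: "run (X - R1) e1 [n] (of_bool (n \<in> A))"
    and e2: "run (X - R2) e2 [n] (of_bool (n \<in> A))" for n
    unfolding turing_le_def computes_def by blast
  \<comment> \<open>The value \<open>1\<close> is the answer "no", so \<open>Q R t\<close>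
    represents the string \<open>t\<close> with \<open>R\<close> removed. Below, \<open>w\<close>
    codes an argument together with a bound.\<close>
  define Q where "Q R t i = (if i \<in> R then 1 else string_query t i)" for R t i
  define val where "val R e w t = ev e (snd (prod_decode w)) (Q R t) [fst (prod_decode w)]" for R e w t
  define disagree where "disagree w t \<longleftrightarrow> \<not> val R1 e1 w t = 0 \<and> \<not> val R2 e2 w t = 0 \<and>
    \<not> val R1 e1 w t = val R2 e2 w t" for w t
  define S where "S = {\<sigma>. \<exists>w. disagree w (string_code \<sigma>)}"
  have "computable_in {} 2 (\<lambda>v. Q R (v ! 0) (v ! 1))" if "computable R" for R
    unfolding Q_def using that
    by (intro computable_intros computable_in_mem) (simp_all add: computable_def)
  note Q = computable_in_ev1[where Q = "Q R" for R, OF this]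
  have val: "computable_in {} 2 (\<lambda>v. val R e (v ! 0) (v ! 1))" if "computable R" for R e
    unfolding val_def by (intro Q[OF that] computable_intros) simp_all
  have "ce_strings S"
    unfolding S_def disagree_def by (intro ce_stringsI computable_intros val comp)
  have Q: "Q R (string_code (initial_segment P s)) = (\<lambda>i. if i \<in> R then 1 else approx P s i)" for R P s
    unfolding Q_def string_query_initial_segment ..
  have sound: "run (P - R) e [fst (prod_decode w)] y"
    if "val R e w (string_code (initial_segment P s)) = Suc y" for P R e w s y
    using that unfolding val_def
    by (rule ev_imp_run[rotated]) (auto simp: Q suboracle_def total_oracle_def approx_def)
  \<comment> \<open>On initial segments of \<open>X\<close> both functionals see their true oracles
    and can only output values of \<open>A\<close>.\<close>
  have "initial_segment X m \<notin> S" for m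
  proof
    assume "initial_segment X m \<in> S"
    then obtain w y z where "val R1 e1 w (string_code (initial_segment X m)) = Suc y"
      "val R2 e2 w (string_code (initial_segment X m)) = Suc z" "y \<noteq> z"
      unfolding S_def disagree_def by (auto simp: gr0_conv_Suc)
    with sound e1 e2 show False using run_deterministic by metis
  qed
  with gen \<open>ce_strings S\<close> obtain m where
    m: "\<And>\<tau>. prefix (initial_segment X m) \<tau> \<Longrightarrow> \<tau> \<notin> S" unfolding one_generic_def by blast
  \<comment> \<open>Only the part of \<open>R2\<close> from \<open>m\<close> on is guessed; below
    \<open>m\<close> the oracle is kept, so that strings built from a guess extend
    \<open>initial_segment X m\<close>.\<close>
  show ?thesis
  proof (rule turing_le_search[where R = "R2 - {..<m}" and B = "X - R1" and e = e1])
    show "R2 - {..<m} \<le>\<^sub>T X - (R1 \<union> R2)"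
      by (intro turing_le_Diff turing_le_finite computable_turing_le comp) simp
    show "X - R1 - (R2 - {..<m}) \<le>\<^sub>T X - (R1 \<union> R2)"
      by (rule turing_le_if_eq_above[OF turing_le_refl, of m]) auto
    show "\<exists>Z y. Z - (R2 - {..<m}) = X - R1 - (R2 - {..<m}) \<and> run Z e1 [n] y" for n
      by (rule exI, rule exI, rule conjI[OF refl e1])
    fix Z n y assume Z: "Z - (R2 - {..<m}) = X - R1 - (R2 - {..<m})" and y: "run Z e1 [n] y"
    \<comment> \<open>Restoring the part of \<open>X\<close> inside \<open>R1\<close> gives one set
      for both functionals: by disjointness, removing \<open>R1\<close> leaves \<open>Z\<close>, and
      removing \<open>R2\<close> leaves \<open>X - R2\<close>.\<close>
    define P where "P = Z \<union> (X \<inter> R1)"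
    have P1: "P - R1 = Z" and P2: "P - R2 = X - R2" and Pm: "i < m \<Longrightarrow> i \<in> P \<longleftrightarrow> i \<in> X" for i
      using Z disj unfolding P_def by blast+
    from run_imp_ev[OF y] obtain s1 where s1: "ev e1 s1 (approx Z s1) [n] = Suc y" ..
    from run_imp_ev[OF e2] obtain s2 where
      s2: "ev e2 s2 (approx (X - R2) s2) [n] = Suc (of_bool (n \<in> A))" ..
    define s where "s = max m (max s1 s2)"
    let ?t = "string_code (initial_segment P s)"
    have sub: "suboracle (approx (P - R) s') (Q R ?t)" if "s' \<le> s" for R s'
      using that by (auto simp: Q suboracle_def approx_def)
    have "val R1 e1 (prod_encode (n, s)) ?t = Suc y"
      unfolding val_def prod_encode_inverse fst_conv snd_conv
      by (rule ev_mono[where s = s1, OF sub[of s1]]) (use s1 in \<open>simp_all add: s_def P1\<close>)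
    moreover have "val R2 e2 (prod_encode (n, s)) ?t = Suc (of_bool (n \<in> A))"
      unfolding val_def prod_encode_inverse fst_conv snd_conv
      by (rule ev_mono[where s = s2, OF sub[of s2]]) (use s2 in \<open>simp_all add: s_def P2\<close>)
    moreover have "initial_segment P s \<notin> S"
      using m prefix_initial_segment[of m s P X] Pm by (simp add: s_def)
    then have "\<not> disagree (prod_encode (n, s)) ?t" unfolding S_def by blast
    ultimately show "y = of_bool (n \<in> A)" unfolding disagree_def by simp
  qed
qed

text \<open>Complete disagreement on \<open>[j, 2j)\<close> makes the density of the difference up
  to \<open>2j\<close> at least 1/2. Such a \<open>j\<close> above any bound can be forced by
  extending a string, so genericity provides one.\<close>

lemma one_generic_not_coarsely_computable:
  assumes gen: "one_generic X" and C: "computable C"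
  shows "\<not> coarse_description C X"
proof
  assume "coarse_description C X"
  then have "partial_density (sym_diff C X) \<longlonglongrightarrow> 0"
    unfolding coarse_description_def has_density_def .
  then have "\<forall>\<^sub>F n in sequentially. partial_density (sym_diff C X) n < 1 / 2"
    by (rule order_tendstoD) simp
  then obtain N where N: "N \<le> n \<Longrightarrow> partial_density (sym_diff C X) n < 1 / 2" for n
    unfolding eventually_sequentially by blast
  define differ where "differ j t \<longleftrightarrow>
    N < j \<and> card {i. i < j \<and> \<not> string_query t (j + i) = Suc (of_bool (\<not> j + i \<in> C))} = 0" for j t
  define S where "S = {\<sigma>. \<exists>j. differ j (string_code \<sigma>)}"
  have "ce_strings S" unfolding S_def differ_def
    by (intro ce_stringsI computable_intros computable_in_mem C[unfolded computable_def]) simp_all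
  have differ: "differ j (string_code (initial_segment P s)) \<longleftrightarrow>
    N < j \<and> 2 * j \<le> s \<and> (\<forall>i<j. j + i \<in> P \<longleftrightarrow> j + i \<notin> C)" for j P s
  proof -
    have "differ j (string_code (initial_segment P s)) \<longleftrightarrow>
        N < j \<and> (\<forall>i<j. approx P s (j + i) = Suc (of_bool (j + i \<notin> C)))"
      unfolding differ_def string_query_initial_segment by auto
    also have "\<dots> \<longleftrightarrow> N < j \<and> (\<forall>i<j. j + i < s \<and> (j + i \<in> P \<longleftrightarrow> j + i \<notin> C))"
      by (auto simp: approx_def of_bool_def split: if_splits)
    also have "\<dots> \<longleftrightarrow> N < j \<and> 2 * j \<le> s \<and> (\<forall>i<j. j + i \<in> P \<longleftrightarrow> j + i \<notin> C)"
    proof (cases "N < j")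
      case True
      then have "(\<forall>i<j. j + i < s) \<longleftrightarrow> 2 * j \<le> s"
        by (auto dest: spec[of _ "j - 1"])
      then show ?thesis by blast
    qed simp
    finally show ?thesis .
  qed
  from gen \<open>ce_strings S\<close> consider m where "initial_segment X m \<in> S"
    | m where "\<And>\<tau>. \<tau> \<in> S \<Longrightarrow> \<not> prefix (initial_segment X m) \<tau>"
    unfolding one_generic_def by blast
  then show False
  proof cases
    case 1
    then obtain j where j: "N < j" "\<forall>i<j. j + i \<in> X \<longleftrightarrow> j + i \<notin> C"
      unfolding S_def using differ by auto
    have "{j..<2 * j} \<subseteq> sym_diff C X \<inter> {0..<2 * j}"
    proof
      fix x assume "x \<in> {j..<2 * j}"
      then have "x - j < j" "j + (x - j) = x" "x < 2 * j" by auto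
      then show "x \<in> sym_diff C X \<inter> {0..<2 * j}" using j(2)[rule_format, of "x - j"] by auto
    qed
    from card_mono[OF _ this] have "j \<le> card (sym_diff C X \<inter> {0..<2 * j})" by simp
    then have "real j / real (2 * j) \<le> partial_density (sym_diff C X) (2 * j)"
      unfolding partial_density_def by (intro divide_right_mono) simp_all
    moreover have "partial_density (sym_diff C X) (2 * j) < 1 / 2" using N j(1) by simp
    ultimately show False using j(1) by simp
  next
    case 2
    define j where "j = max m (Suc N)"
    have "m \<le> j" by (simp add: j_def)
    \<comment> \<open>Following \<open>X\<close> below \<open>j\<close> extends the given initial
      segment; from \<open>j\<close> on, \<open>P\<close> is the complement of
      \<open>C\<close>.\<close>
    define P where "P = {i. if i < j then i \<in> X else i \<notin> C}"
    have "differ j (string_code (initial_segment P (2 * j)))"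
      unfolding differ by (simp add: P_def j_def)
    then have "initial_segment P (2 * j) \<in> S" unfolding S_def by blast
    moreover have "prefix (initial_segment X m) (initial_segment P (2 * j))"
      by (rule prefix_initial_segment) (use \<open>m \<le> j\<close> in \<open>auto simp: P_def\<close>)
    ultimately show False using 2 by blast
  qed
qed


section \<open>The coarse core of a generic set\<close>

text \<open>Within one residue class a number is determined by its quotient.\<close>

lemma card_residue_class_le: "card {i. i < n \<and> i mod N = c} \<le> n div N + 1"
proof -
  have "inj_on (\<lambda>i. i div N) {i. i < n \<and> i mod N = c}"
    by (auto intro!: inj_onI) (metis div_mod_decomp)
  moreover have "(\<lambda>i. i div N) ` {i. i < n \<and> i mod N = c} \<subseteq> {..n div N}"
    by (auto intro: div_le_mono)
  ultimately have "card {i. i < n \<and> i mod N = c} \<le> card {..n div N}"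
    by (rule card_inj_on_le) simp
  then show ?thesis by simp
qed

text \<open>A residue class modulo \<open>2 ^ k\<close> has density \<open>1 / 2 ^ k\<close>, which
  bounds the upper density of the difference for every \<open>k\<close>. Both \<open>m\<close> and
  \<open>c\<close> may depend on \<open>k\<close>.\<close>

lemma coarse_descriptionI:
  assumes "\<And>k. \<exists>m c. \<forall>i\<ge>m. i \<in> sym_diff D X \<longrightarrow> i mod 2 ^ k = c"
  shows "coarse_description D X"
  unfolding coarse_description_def has_density_def
proof (rule LIMSEQ_I)
  fix r :: real assume r: "0 < r"
  \<comment> \<open>Half of \<open>r\<close> pays for the residue class; the other half pays, for
    large \<open>n\<close>, for the elements below \<open>m\<close> and the rounding.\<close>
  obtain k where k: "(1 / 2) ^ k < r / 2" using real_arch_pow_inv[of "r / 2" "1 / 2"] r by auto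
  from assms[of k] obtain m c where mc: "\<And>i. m \<le> i \<Longrightarrow> i \<in> sym_diff D X \<Longrightarrow> i mod 2 ^ k = c"
    by blast
  have bound: "real (card (sym_diff D X \<inter> {0..<n})) \<le> real (m + 1) + real n * (1 / 2) ^ k" for n
  proof -
    have "sym_diff D X \<inter> {0..<n} \<subseteq> {..<m} \<union> {i. i < n \<and> i mod 2 ^ k = c}"
      using mc by (auto simp: not_less)
    then have "card (sym_diff D X \<inter> {0..<n}) \<le> card ({..<m} \<union> {i. i < n \<and> i mod 2 ^ k = c})"
      by (intro card_mono) auto
    also have "\<dots> \<le> m + card {i. i < n \<and> i mod 2 ^ k = c}"
      using card_Un_le[of "{..<m}"] by simp
    also have "\<dots> \<le> m + (n div 2 ^ k + 1)" by (intro add_left_mono card_residue_class_le)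
    finally have "real (card (sym_diff D X \<inter> {0..<n})) \<le> real (m + (n div 2 ^ k + 1))"
      by (rule of_nat_mono)
    also have "\<dots> \<le> real (m + 1) + real n / 2 ^ k"
    proof -
      have "real (n div 2 ^ k * 2 ^ k) \<le> real n" by (intro of_nat_mono div_times_less_eq_dividend)
      then show ?thesis by (simp add: le_divide_eq)
    qed
    finally show ?thesis by (simp add: power_divide)
  qed
  obtain n0 where n0: "real n0 > real (m + 1) * 2 / r" using reals_Archimedean2 by blast
  have "norm (partial_density (sym_diff D X) n - 0) < r" if "n0 \<le> n" for n
  proof -
    have big: "real (m + 1) * 2 / r < real n" using n0 that by linarith
    moreover have "0 \<le> real (m + 1) * 2 / r" using r by simp
    ultimately have n: "0 < real n" by linarith
    have "real (m + 1) < r / 2 * real n" using big r by (simp add: field_simps)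
    moreover have "real n * (1 / 2) ^ k < r / 2 * real n" using k n by simp
    ultimately have "real (card (sym_diff D X \<inter> {0..<n})) < r * real n" using bound[of n] by simp
    then show ?thesis using n unfolding partial_density_def by (simp add: divide_simps)
  qed
  then show "\<exists>n0. \<forall>n\<ge>n0. norm (partial_density (sym_diff D X) n - 0) < r" by blast
qed

section \<open>A finite extension construction inside a decreasing sequence of sets\<close>

instance functional :: countable
  by countable_datatype

text \<open>A stage that cannot be completed for the functional \<open>e\<close> satisfies the hypotheses of
  \<open>turing_le_search\<close>, so that \<open>A\<close> would be computable from \<open>X - R k\<close>.\<close>

lemma avoid_computation:
  assumes R: "\<And>k. computable (R k)" "\<And>k. R (Suc k) \<subseteq> R k"
    and A: "\<And>k. \<not> A \<le>\<^sub>T X - R k"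
  obtains D where "\<And>k. \<exists>m. \<forall>i\<ge>m. i \<in> sym_diff D X \<longrightarrow> i \<in> R k" "\<not> A \<le>\<^sub>T D"
proof -
  \<comment> \<open>A condition \<open>(Y, m)\<close> at stage \<open>k\<close> fixes a set below
    \<open>m\<close> and outside \<open>R k\<close>, with values taken from \<open>Y\<close>. A good
    condition changes \<open>X\<close> only below \<open>m\<close>, and \<open>k \<le> m\<close>
    lets every bit become fixed. Stage \<open>k\<close> defeats the functional numbered
    \<open>k\<close>.\<close>
  define agree where "agree k c Z \<longleftrightarrow> (\<forall>i. i \<notin> R k \<or> i < snd c \<longrightarrow> (i \<in> Z \<longleftrightarrow> i \<in> fst c))"
    for k :: nat and c :: "nat set \<times> nat" and Z
  define good where "good k c \<longleftrightarrow> k \<le> snd c \<and> (\<forall>i\<ge>snd c. i \<in> fst c \<longleftrightarrow> i \<in> X)"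
    for k and c :: "nat set \<times> nat"
  define succ where "succ k c c' \<longleftrightarrow> (\<forall>Z. agree (Suc k) c' Z \<longrightarrow> agree k c Z \<and>
    \<not> computes (from_nat k) Z A)" for k c c'
  have "\<exists>c'. good (Suc k) c' \<and> succ k c c'" if good: "good k c" for k c
  proof -
    obtain Y m where c: "c = (Y, m)" by fastforce
    have Y: "\<And>i. m \<le> i \<Longrightarrow> i \<in> Y \<longleftrightarrow> i \<in> X" and m: "k \<le> m" using good by (auto simp: good_def c)
    let ?e = "from_nat k :: functional"
    have agree: "agree k c Z \<longleftrightarrow> Z - (R k - {..<m}) = Y - (R k - {..<m})" for Z
      unfolding agree_def c set_eq_iff by auto
    have "\<not> (\<forall>n. \<exists>Z y. agree k c Z \<and> run Z ?e [n] y) \<or>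
      \<not> (\<forall>Z n y. agree k c Z \<longrightarrow> run Z ?e [n] y \<longrightarrow> y = of_bool (n \<in> A))"
    proof (rule ccontr)
      assume contr: "\<not> ?thesis"
      have "A \<le>\<^sub>T X - R k"
      proof (rule turing_le_search[where B = Y and R = "R k - {..<m}" and e = ?e])
        show "R k - {..<m} \<le>\<^sub>T X - R k"
          by (intro turing_le_Diff turing_le_finite computable_turing_le R) simp
        show "Y - (R k - {..<m}) \<le>\<^sub>T X - R k"
          by (rule turing_le_if_eq_above[OF turing_le_refl, of m]) (use Y in auto)
      qed (use contr in \<open>simp_all add: agree[symmetric]\<close>)
      with A show False by blast
    qed
    \<comment> \<open>Either no extension of the condition halts at \<open>n\<close>, and any
      stronger condition will do, or some extension \<open>Z\<close> gives a wrong value that is to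
      be preserved.\<close>
    then consider n where "\<And>Z y. agree k c Z \<Longrightarrow> \<not> run Z ?e [n] y"
      | Z n y where "agree k c Z" "run Z ?e [n] y" "y \<noteq> of_bool (n \<in> A)" by blast
    then show ?thesis
    proof cases
      case 1
      have "agree k c Z" if "agree (Suc k) (Y, Suc m) Z" for Z
        using that R(2)[of k] by (auto simp: agree_def c)
      then have "succ k c (Y, Suc m)" unfolding succ_def computes_def using 1 by blast
      moreover have "good (Suc k) (Y, Suc m)" using Y m by (simp add: good_def)
      ultimately show ?thesis by blast
    next
      case 2
      from run_use[OF 2(2)] obtain u where
        u: "\<And>Z'. (\<And>i. i < u \<Longrightarrow> i \<in> Z' \<longleftrightarrow> i \<in> Z) \<Longrightarrow> run Z' ?e [n] y" by metis
      \<comment> \<open>Fixing \<open>Z\<close> beyond its use \<open>u\<close> preserves the wrong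
        value, and returning to \<open>X\<close> afterwards keeps the condition good. The successor
        gives \<open>Suc k \<le> m'\<close>.\<close>
      define m' where "m' = Suc (max m u)"
      define Y' where "Y' = {i. if i < m' then i \<in> Z else i \<in> X}"
      have agree_c: "agree k c Z'" if "agree (Suc k) (Y', m') Z'" for Z'
        unfolding agree_def
      proof (intro allI impI)
        fix i assume i: "i \<notin> R k \<or> i < snd c"
        show "i \<in> Z' \<longleftrightarrow> i \<in> fst c"
        proof (cases "i < m'")
          case True
          then show ?thesis using that 2(1) i by (auto simp: agree_def Y'_def)
        next
          case False
          then have "i \<notin> R (Suc k)" "m \<le> i" using i R(2)[of k] by (auto simp: m'_def c)
          then show ?thesis using that Y[of i] False by (simp add: agree_def Y'_def c)
        qed
      qed
      have "\<not> computes ?e Z' A" if "agree (Suc k) (Y', m') Z'" for Z'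
      proof
        assume "computes ?e Z' A"
        then have "run Z' ?e [n] (of_bool (n \<in> A))" unfolding computes_def ..
        moreover have "run Z' ?e [n] y"
        proof (rule u)
          fix i assume "i < u"
          then have "i < m'" by (simp add: m'_def)
          then show "i \<in> Z' \<longleftrightarrow> i \<in> Z" using that by (simp add: agree_def Y'_def)
        qed
        ultimately show False using 2(3) run_deterministic by blast
      qed
      with agree_c have "succ k c (Y', m')" unfolding succ_def by blast
      moreover have "good (Suc k) (Y', m')" using m by (simp add: good_def Y'_def m'_def)
      ultimately show ?thesis by blast
    qed
  qed
  moreover have "good 0 (X, 0)" by (simp add: good_def)
  ultimately obtain c where good: "\<And>k. good k (c k)" and succ: "\<And>k. succ k (c k) (c (Suc k))"
    using dependent_nat_choice[of good succ] by metis
  have agree_self: "agree k (c k) (fst (c k))" for k by (simp add: agree_def)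
  have "k \<le> j \<Longrightarrow> agree j (c j) Z \<Longrightarrow> agree k (c k) Z" for k j Z
    by (induction rule: dec_induct) (use succ succ_def in blast)+
  then have agree_le: "k \<le> j \<Longrightarrow> agree k (c k) (fst (c j))" for k j using agree_self by blast
  \<comment> \<open>Bit \<open>i\<close> no longer changes from stage \<open>Suc i\<close> on, as
    good conditions there fix more than \<open>i\<close> bits.\<close>
  define D where "D = {i. i \<in> fst (c (Suc i))}"
  have D: "agree k (c k) D" for k
    unfolding agree_def
  proof (intro allI impI)
    fix i assume i: "i \<notin> R k \<or> i < snd (c k)"
    let ?j = "max k (Suc i)"
    have "i < snd (c (Suc i))" using good[of "Suc i"] by (simp add: good_def)
    then have "i \<in> fst (c ?j) \<longleftrightarrow> i \<in> D"
      using agree_le[of "Suc i" ?j] by (simp add: agree_def D_def)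
    moreover have "i \<in> fst (c ?j) \<longleftrightarrow> i \<in> fst (c k)"
      using agree_le[of k ?j] i by (simp add: agree_def)
    ultimately show "i \<in> D \<longleftrightarrow> i \<in> fst (c k)" by simp
  qed
  show ?thesis
  proof (rule that)
    show "\<exists>m. \<forall>i\<ge>m. i \<in> sym_diff D X \<longrightarrow> i \<in> R k" for k
      using D[of k] good[of k] by (intro exI[of _ "snd (c k)"]) (auto simp: agree_def good_def)
    show "\<not> A \<le>\<^sub>T D"
    proof
      assume "A \<le>\<^sub>T D"
      then obtain e where "computes e D A" unfolding turing_le_def by blast
      moreover have "\<not> computes (from_nat (to_nat e)) D A"
        using succ[of "to_nat e"] D unfolding succ_def by blast
      ultimately show False by simp
    qed
  qed
qed

section \<open>Repeated halving of residue classes\<close>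

lemma residue_class_split:
  assumes "c < N"
  shows "{i :: nat. i mod N = c} = {i. i mod (2 * N) = c} \<union> {i. i mod (2 * N) = c + N}"
proof -
  have "i mod N = c \<longleftrightarrow> i mod (2 * N) = c \<or> i mod (2 * N) = c + N" for i
  proof -
    let ?r = "i mod (2 * N)"
    have eq: "i mod N = ?r mod N" by (simp add: mod_mod_cancel)
    have less: "?r < 2 * N" using assms by simp
    show ?thesis
    proof (cases "?r < N")
      case True
      then show ?thesis using assms unfolding eq by simp
    next
      case False
      then have "?r mod N = ?r - N" using less by (simp add: le_mod_geq)
      then show ?thesis using assms False unfolding eq by auto
    qed
  qed
  then show ?thesis by auto
qed

lemma computable_residue_class: "computable {i. i mod N = c}"
  unfolding computable_def turing_le_iff mem_Collect_eq by (intro computable_intros) simp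

lemma one_generic_coarse_core:
  assumes gen: "one_generic X"
  shows "coarse_core X = {A. computable A}"
proof
  show "{A. computable A} \<subseteq> coarse_core X"
    unfolding coarse_core_def using computable_turing_le by blast
  show "coarse_core X \<subseteq> {A. computable A}"
  proof
    fix A assume A: "A \<in> coarse_core X"
    show "A \<in> {A. computable A}"
    proof (rule ccontr)
      assume "A \<notin> {A. computable A}"
      then have noncomp: "\<not> A \<le>\<^sub>T {}" by (simp add: computable_def)
      define bad where "bad k c \<longleftrightarrow> c < 2 ^ k \<and> \<not> A \<le>\<^sub>T X - {i. i mod 2 ^ k = c}" for k c
      let ?half = "\<lambda>k c c'. {i :: nat. i mod 2 ^ Suc k = c'} \<subseteq> {i. i mod 2 ^ k = c}"
      \<comment> \<open>Modulo \<open>1\<close> the only class is everything, so the remaining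
        oracle is empty.\<close>
      have "bad 0 0" using noncomp by (simp add: bad_def)
      moreover have "\<exists>c'. bad (Suc k) c' \<and> ?half k c c'" if "bad k c" for k c
      proof -
        from that have c: "c < 2 ^ k" and A: "\<not> A \<le>\<^sub>T X - {i. i mod 2 ^ k = c}"
          by (simp_all add: bad_def)
        note split = residue_class_split[OF c, folded power_Suc]
        \<comment> \<open>The two halves are disjoint and computable; if removing either one left
          \<open>A\<close> computable, so would removing both.\<close>
        have "\<not> (A \<le>\<^sub>T X - {i. i mod 2 ^ Suc k = c} \<and> A \<le>\<^sub>T X - {i. i mod 2 ^ Suc k = c + 2 ^ k})"
        proof
          assume "A \<le>\<^sub>T X - {i. i mod 2 ^ Suc k = c} \<and> A \<le>\<^sub>T X - {i. i mod 2 ^ Suc k = c + 2 ^ k}"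
          then have "A \<le>\<^sub>T X - ({i. i mod 2 ^ Suc k = c} \<union> {i. i mod 2 ^ Suc k = c + 2 ^ k})"
            by (intro one_generic_turing_le_Diff_Un[OF gen] computable_residue_class) auto
          with A show False unfolding split by blast
        qed
        then have "bad (Suc k) c \<or> bad (Suc k) (c + 2 ^ k)" using c by (auto simp: bad_def)
        then show ?thesis unfolding split by blast
      qed
      ultimately obtain c where "\<And>k. bad k (c k)" and half: "\<And>k. ?half k (c k) (c (Suc k))"
        using dependent_nat_choice[of bad ?half] by metis
      then have bad: "\<not> A \<le>\<^sub>T X - {i. i mod 2 ^ k = c k}" for k by (simp add: bad_def)
      obtain D where D: "\<And>k. \<exists>m. \<forall>i\<ge>m. i \<in> sym_diff D X \<longrightarrow> i \<in> {i. i mod 2 ^ k = c k}"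
        and nD: "\<not> A \<le>\<^sub>T D"
        using avoid_computation[where R = "\<lambda>k. {i. i mod 2 ^ k = c k}", OF computable_residue_class half bad] by blast
      have "coarse_description D X" by (rule coarse_descriptionI) (use D in blast)
      with A nD show False unfolding coarse_core_def by blast
    qed
  qed
qed


section \<open>The embedding\<close>

lemma Least_less_fact:
  assumes "i \<in> factorial_interval k"
  shows "(LEAST j. i < fact (Suc j)) = k"
proof (rule Least_equality)
  show "i < fact (Suc k)" using assms unfolding factorial_interval_def by simp
  fix j assume j: "i < fact (Suc j)"
  show "k \<le> j"
  proof (rule ccontr)
    assume "\<not> k \<le> j"
    then have "fact (Suc j) \<le> (fact k :: nat)" by (intro fact_mono_nat) simp
    with assms j show False unfolding factorial_interval_def by simp
  qed
qed

text \<open>The intervals start at \<open>fact 0 = 1\<close>, so \<open>0\<close> lies in none of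
  them.\<close>

lemma mem_factorial_interval_Least:
  assumes "i \<noteq> 0"
  shows "i \<in> factorial_interval (LEAST j. i < fact (Suc j))"
proof -
  let ?k = "LEAST j. i < fact (Suc j)"
  have "i < fact (Suc i)" using fact_ge_self[of "Suc i"] by linarith
  then have "i < fact (Suc ?k)" by (rule LeastI)
  moreover have "fact ?k \<le> i"
  proof (cases ?k)
    case 0
    then show ?thesis using assms by simp
  next
    case (Suc j)
    then show ?thesis using not_less_Least[of j "\<lambda>j. i < fact (Suc j)"] by simp
  qed
  ultimately show ?thesis unfolding factorial_interval_def by simp
qed

text \<open>The intervals are disjoint, so \<open>i\<close> determines the index \<open>k\<close>,
  and the first component of \<open>k\<close> is the number it codes.\<close>

lemma mem_embedding_coding:
  assumes "i \<in> factorial_interval k"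
  shows "i \<in> \<E> A \<longleftrightarrow> fst (prod_decode k) \<in> A"
proof -
  obtain n j where "prod_decode k = (n, j)" by fastforce
  moreover from this have "k = prod_encode (n, j)" using prod_decode_inverse[of k] by simp
  ultimately have "k \<in> \<H> A \<longleftrightarrow> fst (prod_decode k) \<in> A" by (auto simp: column_coding_def)
  moreover have "i \<in> \<E> A \<longleftrightarrow> k \<in> \<H> A"
    using assms Least_less_fact unfolding embedding_coding_def interval_coding_def by blast
  ultimately show ?thesis by simp
qed

lemma embedding_coding_turing_le: "\<E> A \<le>\<^sub>T A"
proof -
  let ?k = "\<lambda>i. LEAST j. i < fact (Suc j)"
  have "i < fact (Suc i)" for i :: nat using fact_ge_self[of "Suc i"] by linarith
  then have "computable_in A 1 (\<lambda>v. ?k (v ! 0))"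
    by (intro computable_in_Least computable_intros) auto
  then have "computable_in A 1 (\<lambda>v. of_bool (\<not> v ! 0 = 0 \<and> fst (prod_decode (?k (v ! 0))) \<in> A))"
    by (intro computable_intros) simp_all
  moreover have "i \<in> \<E> A \<longleftrightarrow> i \<noteq> 0 \<and> fst (prod_decode (?k i)) \<in> A" for i
  proof (cases "i = 0")
    case True
    then show ?thesis
      by (auto simp: embedding_coding_def interval_coding_def factorial_interval_def)
  next
    case False
    then show ?thesis using mem_embedding_coding[OF mem_factorial_interval_Least] by blast
  qed
  ultimately show ?thesis unfolding turing_le_iff by simp
qed

lemma card_factorial_interval: "card (factorial_interval k) = k * fact k"
  unfolding factorial_interval_def by simp

text \<open>All but finitely many of the intervals coding \<open>n\<close> are decided correctly by majority vote.\<close>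

lemma turing_le_coarse_description_embedding_coding:
  assumes "coarse_description C (\<E> A)"
  shows "A \<le>\<^sub>T C"
proof -
  let ?S = "sym_diff C (\<E> A)"
  from assms have "partial_density ?S \<longlonglongrightarrow> 0"
    unfolding coarse_description_def has_density_def .
  then have "\<forall>\<^sub>F n in sequentially. partial_density ?S n < 1 / 4"
    by (rule order_tendstoD) simp
  then obtain N where N: "N \<le> n \<Longrightarrow> partial_density ?S n < 1 / 4" for n
    unfolding eventually_sequentially by blast
  \<comment> \<open>For \<open>k \<ge> 1\<close> the interval fills at least half of
    \<open>[0, (k+1)!)\<close>. An error density below 1/4 there thus leaves errors on less than
    half of the interval.\<close>
  have errors: "2 * card (?S \<inter> factorial_interval k) < k * fact k" if k: "Suc N \<le> k" for k
  proof -
    let ?n = "fact (Suc k) :: nat"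
    have "N \<le> ?n" using k fact_ge_self[of "Suc k"] by linarith
    from N[OF this] have "real (card (?S \<inter> {0..<?n})) / real ?n < 1 / 4"
      unfolding partial_density_def .
    moreover have "4 * a < n" if "real a / real n < 1 / 4" "0 < n" for a n :: nat
      using that by (simp add: divide_simps)
    ultimately have "4 * card (?S \<inter> {0..<?n}) < ?n" using fact_gt_zero by blast
    moreover have "card (?S \<inter> factorial_interval k) \<le> card (?S \<inter> {0..<?n})"
      by (intro card_mono) (auto simp: factorial_interval_def)
    moreover have "?n \<le> 2 * (k * fact k)"
    proof -
      have "Suc k * fact k \<le> (2 * k) * fact k" by (intro mult_right_mono) (use k in auto)
      then show ?thesis by simp
    qed
    ultimately show ?thesis by linarith
  qed
  \<comment> \<open>One interval of the column of \<open>n\<close> suffices; the second component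
    \<open>Suc N\<close> makes its index large enough for the error bound.\<close>
  define k where "k n = prod_encode (n, Suc N)" for n
  have k: "Suc N \<le> k n" "fst (prod_decode (k n)) = n" for n
    unfolding k_def using le_prod_encode_2 by simp_all
  let ?c = "\<lambda>n. card {i. i < fact (Suc (k n)) \<and> \<not> i < fact (k n) \<and> i \<in> C}"
  have "n \<in> A \<longleftrightarrow> k n * fact (k n) < 2 * ?c n" for n
  proof -
    let ?I = "factorial_interval (k n)"
    have fin: "finite ?I" by (simp add: factorial_interval_def)
    have c: "{i. i < fact (Suc (k n)) \<and> \<not> i < fact (k n) \<and> i \<in> C} = C \<inter> ?I"
      by (auto simp: factorial_interval_def)
    have mem: "i \<in> \<E> A \<longleftrightarrow> n \<in> A" if "i \<in> ?I" for i
      using mem_embedding_coding[OF that] k(2) by simp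
    show ?thesis
    \<comment> \<open>For \<open>n\<close> in \<open>A\<close> the errors in the interval are the
      points missing from \<open>C\<close>; otherwise they are the points of
      \<open>C\<close>.\<close>
    proof (cases "n \<in> A")
      case True
      have "card ?I = card (C \<inter> ?I) + card (?I - C)"
        using card_Int_Diff[OF fin, of C] by (simp add: Int_commute)
      moreover have "card (?I - C) \<le> card (?S \<inter> ?I)"
        using True mem by (intro card_mono) (auto simp: fin)
      ultimately have "k n * fact (k n) < 2 * card (C \<inter> ?I)"
        using errors[OF k(1), of n] card_factorial_interval[of "k n"] by linarith
      with True show ?thesis unfolding c by simp
    next
      case False
      have "card (C \<inter> ?I) \<le> card (?S \<inter> ?I)"
        using False mem by (intro card_mono) (auto simp: fin)
      then have "\<not> k n * fact (k n) < 2 * card (C \<inter> ?I)"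
        using errors[OF k(1), of n] by linarith
      with False show ?thesis unfolding c by simp
    qed
  qed
  moreover have "computable_in C 1 (\<lambda>v. of_bool (k (v ! 0) * fact (k (v ! 0)) < 2 * ?c (v ! 0)))"
    unfolding k_def by (intro computable_intros) simp_all
  ultimately show ?thesis unfolding turing_le_iff by simp
qed

lemma nc_le_embedding_coding_imp_coarse_core: "\<E> A \<le>\<^sub>n\<^sub>c X \<Longrightarrow> A \<in> coarse_core X"
  unfolding nc_le_def coarse_core_def
  using turing_le_trans turing_le_coarse_description_embedding_coding by blast

section \<open>Coarse degrees of generic sets\<close>

lemma coarse_description_refl: "coarse_description X X"
  by (simp add: coarse_description_def has_density_def partial_density_def[abs_def])

lemma nc_le_refl: "X \<le>\<^sub>n\<^sub>c X"
  unfolding nc_le_def using turing_le_refl by blast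

lemma uc_le_refl: "X \<le>\<^sub>u\<^sub>c X"
  unfolding uc_le_def computes_def using run_Query by blast

lemma uc_le_imp_nc_le: "Y \<le>\<^sub>u\<^sub>c X \<Longrightarrow> Y \<le>\<^sub>n\<^sub>c X"
  unfolding uc_le_def nc_le_def turing_le_def by blast

theorem theorem4p2:
  fixes X :: "nat set"
  assumes "one_generic X"
  shows "coarse_core X = {A. computable A} \<and>
    (\<forall>A. \<not> computable A \<longrightarrow> \<not> \<E> A \<le>\<^sub>n\<^sub>c X) \<and>
    (uc_degree X \<notin> uc_embedding_image \<and> nc_degree X \<notin> nc_embedding_image) \<and>
    (\<forall>B. \<not> X \<equiv>\<^sub>u\<^sub>c \<E> B \<and> \<not> X \<equiv>\<^sub>n\<^sub>c \<E> B)"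
proof -
  note core = one_generic_coarse_core[OF assms]
  have computable: "computable A" if "\<E> A \<le>\<^sub>n\<^sub>c X" for A
    using nc_le_embedding_coding_imp_coarse_core[OF that] core by blast
  have nc: "\<not> X \<equiv>\<^sub>n\<^sub>c \<E> B" for B
  proof
    assume equiv: "X \<equiv>\<^sub>n\<^sub>c \<E> B"
    then have "computable B" using computable by (simp add: nc_equiv_def)
    \<comment> \<open>\<open>\<E> B\<close> is a coarse description of itself, hence computes some
      coarse description of \<open>X\<close>; it is in turn computable from the computable set
      \<open>B\<close>.\<close>
    from equiv obtain C where "C \<le>\<^sub>T \<E> B" and C: "coarse_description C X"
      unfolding nc_equiv_def nc_le_def using coarse_description_refl by blast
    then have "computable C"
      using \<open>computable B\<close> embedding_coding_turing_le turing_le_trans unfolding computable_def by blast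
    with C one_generic_not_coarsely_computable[OF assms] show False by blast
  qed
  have uc: "\<not> X \<equiv>\<^sub>u\<^sub>c \<E> B" for B
    using nc uc_le_imp_nc_le unfolding uc_equiv_def nc_equiv_def by blast
  have "uc_degree X \<noteq> uc_degree (\<E> A)" for A
  proof
    assume "uc_degree X = uc_degree (\<E> A)"
    moreover have "\<E> A \<in> uc_degree (\<E> A)" by (simp add: uc_degree_def uc_equiv_def uc_le_refl)
    ultimately have "\<E> A \<in> uc_degree X" by simp
    then show False using uc by (simp add: uc_degree_def)
  qed
  moreover have "nc_degree X \<noteq> nc_degree (\<E> A)" for A
  proof
    assume "nc_degree X = nc_degree (\<E> A)"
    moreover have "\<E> A \<in> nc_degree (\<E> A)" by (simp add: nc_degree_def nc_equiv_def nc_le_refl)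
    ultimately have "\<E> A \<in> nc_degree X" by simp
    then show False using nc by (simp add: nc_degree_def)
  qed
  ultimately have "uc_degree X \<notin> uc_embedding_image \<and> nc_degree X \<notin> nc_embedding_image"
    unfolding uc_embedding_image_def nc_embedding_image_def by blast
  moreover have "\<forall>A. \<not> computable A \<longrightarrow> \<not> \<E> A \<le>\<^sub>n\<^sub>c X" using computable by blast
  ultimately show ?thesis using core nc uc by simp
qed

end
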